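(* Let $\Gamma$ be a row-finite digraph, $\mathbb F$ a field, and $L(\Gamma)$ the Leavitt path algebra of $\Gamma$ over $\mathbb F$. Then $L(\Gamma)$ has a nonzero finite dimensional module (equivalently, a nonzero finite dimensional quotient) if and only if $\Gamma$ has a maximal sink or a maximal cycle with finitely many predecessors.
   Context: A digraph $\Gamma=(V,E,s,t)$ has vertex set $V$, arrow set $E$ (possibly infinite) and source and target maps $s,t:E\to V$. It is row-finite if $s^{-1}(v)$ is finite for all $v\in V$. $L(\Gamma)$ is the (not necessarily unital) $\mathbb F$-algebra generated by $V\sqcup E\sqcup E^*$, where $E^*=\{e^*: e\in E\}$, $s(e^* )=t(e)$, $t(e^* )=s(e)$, subject to: (V) $vw=\delta_{v,w}v$ for $v,w\in V$; (E) $s(e)e=e=e\,t(e)$ for $e\in E\sqcup E^*$; (CK1) $e^*f=\delta_{e,f}\,t(e)$ for $e,f\in E$; (CK2) $v=\sum_{s(e)=v}ee^*$ for every $v\in V$ with $s^{-1}(v)\neq\emptyset$. Modules are right modules $M$ that are unital: $ML(\Gamma)=M$. A sink is a vertex $v$ with $s^{-1}(v)=\emptyset$. A path is a sequence $e_1\cdots e_n$ of arrows with $t(e_i)=s(e_{i+1})$, or a vertex (length $0$). A cycle is a path $e_1\cdots e_n$, $n>0$, with $t(e_n)=s(e_1)$ and $s(e_i)\ne s(e_j)$ for $i\neq j$; cyclic rotations of a cycle are regarded as the same cycle. For vertices, $v\leadsto w$ means there is a path from $v$ to $w$. For $u',u$ each a sink or a cycle, $u'\leadsto u$ means there is a path from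 (a vertex of) $u'$ to (a vertex of) $u$. A sink or a cycle $u$ is maximal if, for every sink or cycle $u'$, $u'\leadsto u$ only if $u'=u$. The predecessors of a vertex $v$ are the vertices $w$ with $w\leadsto v$; the predecessors of a cycle are the predecessors of any vertex on it. The condition "finitely many predecessors" applies to the maximal sink as well as to the maximal cycle. *)

theory Defs
  imports
    "HOL-Algebra.QuotRing"
    "Graph_Theory.Arc_Walk"
    "Jordan_Normal_Form.Missing_VectorSpace"
begin

section \<open>Not necessarily unital algebras over a field\<close>

text \<open>
  Algebras are carried by the record type \<open>module\<close> of HOL-Algebra.  That record has a field
  \<open>one\<close>, but the algebras here have no unit in general: the field is filled with a dummy
  value and never referred to.
\<close>

definition algebra_ideal ::
    "('k, 'r) ring_scheme \<Rightarrow> ('k, 'a, 's) module_scheme \<Rightarrow> 'a set \<Rightarrow> bool" where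
  "algebra_ideal F A I \<longleftrightarrow>
     submodule F I A \<and>
     (\<forall>a\<in>carrier A. \<forall>x\<in>I. a \<otimes>\<^bsub>A\<^esub> x \<in> I \<and> x \<otimes>\<^bsub>A\<^esub> a \<in> I)"

definition ideal_generated ::
    "('k, 'r) ring_scheme \<Rightarrow> ('k, 'a, 's) module_scheme \<Rightarrow> 'a set \<Rightarrow> 'a set" where
  "ideal_generated F A S = \<Inter>{I. algebra_ideal F A I \<and> S \<subseteq> I}"

definition quotient_algebra ::
    "('k, 'a, 's) module_scheme \<Rightarrow> 'a set \<Rightarrow> ('k, 'a set) module" where
  "quotient_algebra A I =
     \<lparr>carrier = a_rcosets\<^bsub>A\<^esub> I, mult = rcoset_mult A I, one = undefined, zero = I,
      add = set_add A, smult = (\<lambda>c X. \<Union>x\<in>X. I +>\<^bsub>A\<^esub> (c \<odot>\<^bsub>A\<^esub> x))\<rparr>"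

text \<open>
  The free algebra without unit on a set \<open>X\<close>: finitely supported functions on the nonempty
  words over \<open>X\<close>.  The convolution product sums over all ways of cutting a word in two.
\<close>

definition free_algebra ::
    "('k, 'r) ring_scheme \<Rightarrow> 'x set \<Rightarrow> ('k, 'x list \<Rightarrow> 'k) module" where
  "free_algebra F X =
     \<lparr>carrier = {f. (\<forall>w. f w \<in> carrier F) \<and> finite {w. f w \<noteq> \<zero>\<^bsub>F\<^esub>} \<and>
                    (\<forall>w. f w \<noteq> \<zero>\<^bsub>F\<^esub> \<longrightarrow> w \<noteq> [] \<and> set w \<subseteq> X)},
      mult = (\<lambda>f g w. \<Oplus>\<^bsub>F\<^esub>i\<in>{..length w}. f (take i w) \<otimes>\<^bsub>F\<^esub> g (drop i w)),
      one = undefined,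
      zero = (\<lambda>w. \<zero>\<^bsub>F\<^esub>),
      add = (\<lambda>f g w. f w \<oplus>\<^bsub>F\<^esub> g w),
      smult = (\<lambda>c f w. c \<otimes>\<^bsub>F\<^esub> f w)\<rparr>"

definition monomial :: "('k, 'r) ring_scheme \<Rightarrow> 'x list \<Rightarrow> 'x list \<Rightarrow> 'k" where
  "monomial F u = (\<lambda>w. if w = u then \<one>\<^bsub>F\<^esub> else \<zero>\<^bsub>F\<^esub>)"


section \<open>Leavitt path algebras\<close>

definition row_finite :: "('v, 'e) pre_digraph \<Rightarrow> bool" where
  "row_finite G \<longleftrightarrow> (\<forall>v\<in>verts G. finite (out_arcs G v))"

text \<open>\<open>Ghost e\<close> stands for the formal symbol \<open>e\<close>-star.\<close>

datatype ('v, 'e) generator = Vertex 'v | Arrow 'e | Ghost 'e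

definition generators :: "('v, 'e) pre_digraph \<Rightarrow> ('v, 'e) generator set" where
  "generators G = Vertex ` verts G \<union> Arrow ` arcs G \<union> Ghost ` arcs G"

text \<open>
  \<open>leavitt_rel F G x y\<close> means that \<open>x = y\<close> is one of the defining relations.  The graph
  library writes \<open>tail\<close> for the source and \<open>head\<close> for the target of an arrow.  The sum in
  \<open>CK2\<close> has its intended meaning only for row-finite graphs.
\<close>

inductive leavitt_rel ::
    "('k, 'r) ring_scheme \<Rightarrow> ('v, 'e) pre_digraph \<Rightarrow>
     (('v, 'e) generator list \<Rightarrow> 'k) \<Rightarrow> (('v, 'e) generator list \<Rightarrow> 'k) \<Rightarrow> bool"
  for F G where
  V: "\<lbrakk>v \<in> verts G; w \<in> verts G\<rbrakk> \<Longrightarrow>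
      leavitt_rel F G (monomial F [Vertex v, Vertex w])
        (if v = w then monomial F [Vertex v] else \<zero>\<^bsub>free_algebra F (generators G)\<^esub>)"
| E_arrow_source: "e \<in> arcs G \<Longrightarrow>
      leavitt_rel F G (monomial F [Vertex (tail G e), Arrow e]) (monomial F [Arrow e])"
| E_arrow_target: "e \<in> arcs G \<Longrightarrow>
      leavitt_rel F G (monomial F [Arrow e, Vertex (head G e)]) (monomial F [Arrow e])"
| E_ghost_source: "e \<in> arcs G \<Longrightarrow>
      leavitt_rel F G (monomial F [Vertex (head G e), Ghost e]) (monomial F [Ghost e])"
| E_ghost_target: "e \<in> arcs G \<Longrightarrow>
      leavitt_rel F G (monomial F [Ghost e, Vertex (tail G e)]) (monomial F [Ghost e])"
| CK1: "\<lbrakk>e \<in> arcs G; f \<in> arcs G\<rbrakk> \<Longrightarrow>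
      leavitt_rel F G (monomial F [Ghost e, Arrow f])
        (if e = f then monomial F [Vertex (head G e)] else \<zero>\<^bsub>free_algebra F (generators G)\<^esub>)"
| CK2: "\<lbrakk>v \<in> verts G; out_arcs G v \<noteq> {}\<rbrakk> \<Longrightarrow>
      leavitt_rel F G (monomial F [Vertex v])
        (\<Oplus>\<^bsub>free_algebra F (generators G)\<^esub>e\<in>out_arcs G v. monomial F [Arrow e, Ghost e])"

definition leavitt_path_algebra ::
    "('k, 'r) ring_scheme \<Rightarrow> ('v, 'e) pre_digraph \<Rightarrow>
     ('k, (('v, 'e) generator list \<Rightarrow> 'k) set) module" where
  "leavitt_path_algebra F G =
     (let A = free_algebra F (generators G)
      in quotient_algebra A
           (ideal_generated F A {x \<ominus>\<^bsub>A\<^esub> y | x y. leavitt_rel F G x y}))"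


section \<open>Unital right modules and finite dimensionality\<close>

locale unital_right_module = vectorspace F M
  for F :: "('k, 'r) ring_scheme" and A :: "('k, 'a, 's) module_scheme"
    and M :: "('k, 'm, 't) module_scheme" and act :: "'m \<Rightarrow> 'a \<Rightarrow> 'm" +
  assumes act_closed:
      "\<lbrakk>x \<in> carrier M; a \<in> carrier A\<rbrakk> \<Longrightarrow> act x a \<in> carrier M"
    and act_add_left:
      "\<lbrakk>x \<in> carrier M; y \<in> carrier M; a \<in> carrier A\<rbrakk> \<Longrightarrow>
       act (x \<oplus>\<^bsub>M\<^esub> y) a = act x a \<oplus>\<^bsub>M\<^esub> act y a"
    and act_add_right:
      "\<lbrakk>x \<in> carrier M; a \<in> carrier A; b \<in> carrier A\<rbrakk> \<Longrightarrow>
       act x (a \<oplus>\<^bsub>A\<^esub> b) = act x a \<oplus>\<^bsub>M\<^esub> act x b"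
    and act_smult_left:
      "\<lbrakk>c \<in> carrier F; x \<in> carrier M; a \<in> carrier A\<rbrakk> \<Longrightarrow>
       act (c \<odot>\<^bsub>M\<^esub> x) a = c \<odot>\<^bsub>M\<^esub> act x a"
    and act_smult_right:
      "\<lbrakk>c \<in> carrier F; x \<in> carrier M; a \<in> carrier A\<rbrakk> \<Longrightarrow>
       act x (c \<odot>\<^bsub>A\<^esub> a) = c \<odot>\<^bsub>M\<^esub> act x a"
    and act_mult:
      "\<lbrakk>x \<in> carrier M; a \<in> carrier A; b \<in> carrier A\<rbrakk> \<Longrightarrow>
       act x (a \<otimes>\<^bsub>A\<^esub> b) = act (act x a) b"
    and unital:
      "x \<in> carrier M \<Longrightarrow>
       \<exists>(n::nat) m a. (\<forall>i<n. m i \<in> carrier M \<and> a i \<in> carrier A) \<and>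
         x = (\<Oplus>\<^bsub>M\<^esub>i\<in>{..<n}. act (m i) (a i))"

definition nonzero_finite_dimensional ::
    "('k, 'r) ring_scheme \<Rightarrow> ('k, 'm, 't) module_scheme \<Rightarrow> bool" where
  "nonzero_finite_dimensional F V \<longleftrightarrow>
     vectorspace F V \<and> vectorspace.fin_dim F V \<and> carrier V \<noteq> {\<zero>\<^bsub>V\<^esub>}"

text \<open>
  The first argument names the type in which the module is to be found, since a formula of
  HOL cannot quantify over all types.  Every finite dimensional vector space over \<open>F\<close> has an
  isomorphic copy in \<open>nat \<Rightarrow> 'k\<close>, where \<open>'k\<close> is the type of the scalars.
\<close>

definition has_nonzero_fd_module ::
    "'m itself \<Rightarrow> ('k, 'r) ring_scheme \<Rightarrow> ('k, 'a, 's) module_scheme \<Rightarrow> bool" where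
  "has_nonzero_fd_module T F A \<longleftrightarrow>
     (\<exists>(M :: ('k, 'm) module) act.
        unital_right_module F A M act \<and> nonzero_finite_dimensional F M)"

definition has_nonzero_fd_quotient ::
    "('k, 'r) ring_scheme \<Rightarrow> ('k, 'a, 's) module_scheme \<Rightarrow> bool" where
  "has_nonzero_fd_quotient F A \<longleftrightarrow>
     (\<exists>I. algebra_ideal F A I \<and> nonzero_finite_dimensional F (quotient_algebra A I))"


section \<open>Maximal sinks and cycles\<close>

definition leads_to :: "('v, 'e) pre_digraph \<Rightarrow> 'v \<Rightarrow> 'v \<Rightarrow> bool" where
  "leads_to G v w \<longleftrightarrow> (\<exists>p. pre_digraph.awalk G v p w)"

text \<open>
  Cycles are represented by their sets of rotations, so that cyclic rotations of a cycle are
  the same cycle.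
\<close>

datatype ('v, 'e) sink_or_cycle = Sink 'v | Cycle "'e list set"

fun is_sink_or_cycle :: "('v, 'e) pre_digraph \<Rightarrow> ('v, 'e) sink_or_cycle \<Rightarrow> bool" where
  "is_sink_or_cycle G (Sink v) \<longleftrightarrow> v \<in> verts G \<and> out_arcs G v = {}"
| "is_sink_or_cycle G (Cycle C) \<longleftrightarrow>
     (\<exists>p. pre_digraph.cycle G p \<and> C = range (\<lambda>n. rotate n p))"

fun vertices_of :: "('v, 'e) pre_digraph \<Rightarrow> ('v, 'e) sink_or_cycle \<Rightarrow> 'v set" where
  "vertices_of G (Sink v) = {v}"
| "vertices_of G (Cycle C) = (\<Union>p\<in>C. tail G ` set p)"

definition maximal_sink_or_cycle ::
    "('v, 'e) pre_digraph \<Rightarrow> ('v, 'e) sink_or_cycle \<Rightarrow> bool" where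
  "maximal_sink_or_cycle G u \<longleftrightarrow>
     is_sink_or_cycle G u \<and>
     (\<forall>u'. is_sink_or_cycle G u' \<and>
        (\<exists>v\<in>vertices_of G u'. \<exists>w\<in>vertices_of G u. leads_to G v w) \<longrightarrow> u' = u)"

definition predecessors ::
    "('v, 'e) pre_digraph \<Rightarrow> ('v, 'e) sink_or_cycle \<Rightarrow> 'v set" where
  "predecessors G u = {w \<in> verts G. \<exists>v\<in>vertices_of G u. leads_to G w v}"

end

theory Submission
  imports Defs
begin

text \<open>
  A unital right module \<open>M\<close> is the sum of the spaces \<open>M v\<close>, and (CK1), (CK2) say that
  multiplication by the arrows out of a non-sink \<open>v\<close> identifies \<open>M v\<close> with the direct sum of
  the spaces \<open>M t(e)\<close> over \<open>s(e) = v\<close>.  If \<open>M\<close> is finite dimensional, the set \<open>S\<close> of vertices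
  with \<open>M v \<noteq> 0\<close> is finite and closed under predecessors, and every non-sink of \<open>S\<close> has an arrow
  into \<open>S\<close>.  For a cycle \<open>c\<close> at \<open>v \<in> S\<close>, right multiplication by \<open>c\<close>-star is injective on \<open>M v\<close>,
  hence onto, so by (CK1) every other arrow out of \<open>v\<close> annihilates \<open>M v\<close>: cycles in \<open>S\<close> have no
  exit into \<open>S\<close>.  Therefore all sinks and cycles in \<open>S\<close> are maximal, and one of them exists.

  Conversely, fix a vertex \<open>b\<close> on a maximal sink or cycle with finitely many predecessors.  By
  maximality there are only finitely many paths that end at \<open>b\<close> and do not meet \<open>b\<close> earlier.
  They are the basis of a module on which ghost arrows prepend an arrow (a completed cycle at \<open>b\<close>
  being replaced by the empty path) and arrows remove it again.  The quotient by its annihilator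
  is finite dimensional.
\<close>

text \<open>Two points shape the proof. First, the algebra has no unit in general; finite sums of
  vertices take its place. A word absorbs on its right the vertex at which its last letter ends, so
  every element has a right local unit. Hence every quotient of the algebra is a unital right
  module, and only modules have to be analysed; likewise each vector of a unital module is killed by
  almost all vertices, which makes \<open>S\<close> finite. Second, maximality speaks about all
  sinks and cycles. What leads into \<open>S\<close> lies in \<open>S\<close>, and a walk between
  vertices of \<open>S\<close> that starts on a cycle cannot leave that cycle; so nothing outside
  \<open>S\<close> has to be inspected. If \<open>S\<close> has no sink, walks inside
  \<open>S\<close> go on forever and a repetition yields a cycle. In the converse, maximality is
  used through one consequence: a cycle leading to \<open>b\<close> is the chosen one and contains
  \<open>b\<close>. So the basis paths repeat no vertex, and there is only one way of closing a
  cycle at \<open>b\<close>, as (CK1) demands. The annihilator quotient embeds into the matrices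
  indexed by pairs of basis paths.\<close>

section \<open>Finite dimensional vector spaces\<close>

lemma (in linear_map) inj_image_lin_indpt:
  assumes inj: "inj_on T (carrier V)" and B: "B \<subseteq> carrier V" and fin: "finite B"
    and li: "V.module.lin_indpt B"
  shows "W.module.lin_indpt (T ` B)"
proof (rule W.module.finite_lin_indpt2)
  show "finite (T ` B)" using fin by simp
  show "T ` B \<subseteq> carrier W" using B by auto
  fix a assume a: "a \<in> T ` B \<rightarrow> carrier K" and lc: "W.module.lincomb a (T ` B) = \<zero>\<^bsub>W\<^esub>"
  have aT: "a \<circ> T \<in> B \<rightarrow> carrier K" using a by auto
  then have "V.module.lincomb (a \<circ> T) B \<in> carrier V" using B by simp
  moreover have "T (V.module.lincomb (a \<circ> T) B) = T \<zero>\<^bsub>V\<^esub>"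
    using lincomb_linear_image[OF inj B a fin] lc by simp
  ultimately have "V.module.lincomb (a \<circ> T) B = \<zero>\<^bsub>V\<^esub>"
    using inj by (meson V.module.M.zero_closed inj_onD)
  then have "\<forall>v\<in>B. (a \<circ> T) v = \<zero>\<^bsub>K\<^esub>"
    using li fin aT unfolding V.module.lin_dep_def by blast
  then show "\<forall>v\<in>T ` B. a v = \<zero>\<^bsub>K\<^esub>" by auto
qed

text \<open>The image of a basis is independent of size \<open>dim\<close>, hence again a basis. In
  \<open>support_no_exit\<close> this turns injectivity of a ghost cycle into surjectivity.\<close>

lemma (in vectorspace) linear_inj_imp_surj:
  assumes T: "linear_map K V V T" and fd: "fin_dim" and inj: "inj_on T (carrier V)"
  shows "T ` carrier V = carrier V"
proof -
  interpret T: linear_map K V V T by fact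
  obtain B where B: "finite B" "basis B" using finite_basis_exists[OF fd] by blast
  then have BV: "B \<subseteq> carrier V" and li: "lin_indpt B"
    unfolding basis_def by auto
  have "card (T ` B) = dim"
    using card_image[OF inj_on_subset[OF inj BV]] dim_basis[OF B] by simp
  then have "basis (T ` B)"
    using dim_li_is_basis[OF fd finite_imageI[OF B(1)], of T]
      T.inj_image_lin_indpt[OF inj BV B(1) li] BV T.T_im by auto
  then have "span (T ` B) = carrier V" unfolding basis_def by simp
  moreover have "span (T ` B) \<subseteq> T ` carrier V"
    using span_is_subset[OF _ T.im_is_submodule, of "T ` B"] BV
    unfolding T.im_def by auto
  ultimately show ?thesis using T.T_im by auto
qed

text \<open>Independent sets of the domain are bounded in size by \<open>W.dim\<close>; a maximal
  one therefore exists, is finite, and is a basis.\<close>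

lemma (in linear_map) inj_imp_fin_dim:
  assumes fd: "W.fin_dim" and inj: "inj_on T (carrier V)"
  shows "V.fin_dim"
proof -
  have bound: "finite A \<and> card A \<le> W.dim" if A: "A \<subseteq> carrier V \<and> V.module.lin_indpt A" for A
  proof -
    \<comment> \<open>Finite subsets are compared with the dimension first; an infinite
      \<open>A\<close> would contain one with \<open>W.dim + 1\<close> elements.\<close>
    have *: "card B \<le> W.dim" if "finite B" "B \<subseteq> A" for B
    proof -
      have BV: "B \<subseteq> carrier V" using that A by auto
      have "V.module.lin_indpt B" using A that(2) unfolding V.module.lin_dep_def by blast
      then have "card (T ` B) \<le> W.dim"
        using W.li_le_dim[OF fd, of "T ` B"] inj_image_lin_indpt[OF inj BV that(1)] BV by auto
      then show ?thesis using card_image[OF inj_on_subset[OF inj BV]] by simp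
    qed
    then have "finite A"
      by (metis Suc_n_not_le_n infinite_arbitrarily_large)
    with * show ?thesis by auto
  qed
  have "{} \<subseteq> carrier V \<and> V.module.lin_indpt {}" unfolding V.module.lin_dep_def by auto
  from maximal_exists[where P = "\<lambda>S. S \<subseteq> carrier V \<and> V.module.lin_indpt S", OF bound this] obtain A
    where A: "finite A" "maximal A (\<lambda>S. S \<subseteq> carrier V \<and> V.module.lin_indpt S)" by blast
  then show ?thesis
    using V.max_li_is_basis[OF A(2)] unfolding V.fin_dim_def V.basis_def by blast
qed

lemma (in module) finsum_submodule_closed:
  assumes N: "submodule R N M" and f: "f \<in> A \<rightarrow> N"
  shows "finsum M f A \<in> N"
  using f
proof (induct A rule: infinite_finite_induct)
  case (infinite A)
  then show ?case using submodule.zero_closed[OF N] by (simp add: finsum_infinite)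
next
  case empty
  then show ?case using submodule.zero_closed[OF N] by simp
next
  case (insert x A)
  have "N \<subseteq> carrier M" by (rule submodule.subset[OF N])
  then have "finsum M f (insert x A) = f x \<oplus>\<^bsub>M\<^esub> finsum M f A"
    using insert by (intro M.finsum_insert) auto
  then show ?case using insert submodule.m_closed[OF N] by simp
qed

text \<open>Serves to move evaluation at a point, the coset map and the action of a fixed element
  through sums. For an infinite index set both sums default to zero, which an additive map
  preserves.\<close>

lemma additive_finsum:
  assumes "abelian_group A" "abelian_group B"
    and closed: "\<And>x. x \<in> carrier A \<Longrightarrow> h x \<in> carrier B"
    and add: "\<And>x y. x \<in> carrier A \<Longrightarrow> y \<in> carrier A \<Longrightarrow> h (x \<oplus>\<^bsub>A\<^esub> y) = h x \<oplus>\<^bsub>B\<^esub> h y"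
    and f: "f \<in> S \<rightarrow> carrier A"
  shows "h (finsum A f S) = finsum B (\<lambda>i. h (f i)) S"
proof -
  interpret A: abelian_group A by fact
  interpret B: abelian_group B by fact
  have "h \<zero>\<^bsub>A\<^esub> \<oplus>\<^bsub>B\<^esub> h \<zero>\<^bsub>A\<^esub> = h \<zero>\<^bsub>A\<^esub>" using add[of "\<zero>\<^bsub>A\<^esub>" "\<zero>\<^bsub>A\<^esub>"] by simp
  then have zero: "h \<zero>\<^bsub>A\<^esub> = \<zero>\<^bsub>B\<^esub>" using closed[OF A.zero_closed]
    by (metis B.add.r_cancel_one B.add.m_comm)
  from f show ?thesis
  proof (induct S rule: infinite_finite_induct)
    case (insert x S)
    then have "f x \<in> carrier A" "f \<in> S \<rightarrow> carrier A" "(\<lambda>i. h (f i)) \<in> S \<rightarrow> carrier B"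
      using closed by auto
    then show ?case using insert closed by (simp add: add)
  qed (simp_all add: zero A.finsum_infinite B.finsum_infinite)
qed

section \<open>Function spaces and their standard bases\<close>

lemma (in cring) func_space_finsum:
  assumes "f \<in> A \<rightarrow> carrier (func_space S)" "s \<in> S"
  shows "finsum (func_space S) f A s = (\<Oplus>i\<in>A. f i s)"
proof -
  interpret M: module R "func_space S" by (rule func_space_is_module)
  show ?thesis
    by (rule additive_finsum[OF M.M.abelian_group_axioms is_abelian_group, where h = "\<lambda>g. g s"])
      (use assms in \<open>auto simp: func_space_def\<close>)
qed

text \<open>The standard basis vectors, restricted to \<open>S\<close> because the carrier of
  \<open>func_space\<close> consists of extensional functions.\<close>

definition (in ring) unit_fun :: "'z set \<Rightarrow> 'z \<Rightarrow> 'z \<Rightarrow> 'a" where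
  "unit_fun S s = (\<lambda>t\<in>S. if t = s then \<one> else \<zero>)"

lemma (in ring) unit_fun_closed [simp]: "unit_fun S s \<in> carrier (func_space S)"
  by (auto simp: unit_fun_def func_space_def)

lemma (in cring) func_space_expand:
  assumes "finite S" and f: "f \<in> carrier (func_space S)"
  shows "f = (\<Oplus>\<^bsub>func_space S\<^esub>s\<in>S. f s \<odot>\<^bsub>func_space S\<^esub> unit_fun S s)"
proof -
  interpret M: module R "func_space S" by (rule func_space_is_module)
  have fR: "f s \<in> carrier R" if "s \<in> S" for s
    using f that by (auto simp: func_space_def)
  then have terms: "(\<lambda>s. f s \<odot>\<^bsub>func_space S\<^esub> unit_fun S s) \<in> S \<rightarrow> carrier (func_space S)"
    by auto
  show ?thesis
  proof
    fix t
    show "f t = (\<Oplus>\<^bsub>func_space S\<^esub>s\<in>S. f s \<odot>\<^bsub>func_space S\<^esub> unit_fun S s) t"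
    proof (cases "t \<in> S")
      case True
      have "(\<Oplus>\<^bsub>func_space S\<^esub>s\<in>S. f s \<odot>\<^bsub>func_space S\<^esub> unit_fun S s) t
          = (\<Oplus>s\<in>S. (f s \<odot>\<^bsub>func_space S\<^esub> unit_fun S s) t)"
        by (rule func_space_finsum[OF terms True])
      also have "\<dots> = (\<Oplus>s\<in>S. if t = s then f s else \<zero>)"
        using fR True by (intro add.finprod_cong') (auto simp: func_space_def unit_fun_def)
      also have "\<dots> = f t"
        using fR True assms(1) by (intro add.finprod_singleton) auto
      finally show ?thesis by simp
    next
      case False
      moreover have "(\<Oplus>\<^bsub>func_space S\<^esub>s\<in>S. f s \<odot>\<^bsub>func_space S\<^esub> unit_fun S s) \<in> carrier (func_space S)"
        using terms by (rule M.M.finsum_closed)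
      ultimately show ?thesis using f by (auto simp: func_space_def PiE_def extensional_def)
    qed
  qed
qed

lemma (in field) func_space_vectorspace: "vectorspace R (func_space S)"
  by (intro vectorspace.intro func_space_is_module field_axioms)

lemma (in field) func_space_fin_dim:
  assumes "finite S"
  shows "vectorspace.fin_dim R (func_space S)"
proof -
  interpret M: vectorspace R "func_space S" by (rule func_space_vectorspace)
  let ?B = "unit_fun S ` S"
  have B: "?B \<subseteq> carrier (func_space S)" by auto
  have sub: "submodule R (M.span ?B) (func_space S)" by (rule M.span_is_submodule[OF B])
  have "f \<in> M.span ?B" if f: "f \<in> carrier (func_space S)" for f
  proof -
    have "(\<lambda>s. f s \<odot>\<^bsub>func_space S\<^esub> unit_fun S s) \<in> S \<rightarrow> M.span ?B"
    proof
      fix s assume s: "s \<in> S"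
      then have "f s \<in> carrier R" using f by (auto simp: func_space_def)
      then show "f s \<odot>\<^bsub>func_space S\<^esub> unit_fun S s \<in> M.span ?B"
        using M.in_own_span[OF B] s by (intro submodule.smult_closed[OF sub]) auto
    qed
    from M.finsum_submodule_closed[OF sub this] show ?thesis
      using func_space_expand[OF assms f] by simp
  qed
  then have "M.gen_set ?B" using M.span_is_subset2[OF B] by auto
  then show ?thesis unfolding M.fin_dim_def using assms B by blast
qed

section \<open>Quotients of algebras without unit\<close>

text \<open>The field \<open>one\<close> of these records is a dummy, so only bilinearity and
  associativity are recorded. Instances are the free algebra, its quotient \<open>L.Q\<close> and
  the quotients of \<open>L.Q\<close>.\<close>

locale nonunital_algebra = module F A for F and A +
  assumes mult_closed [simp]: "a \<in> carrier A \<Longrightarrow> b \<in> carrier A \<Longrightarrow> a \<otimes>\<^bsub>A\<^esub> b \<in> carrier A"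
    and mult_l_distr: "\<lbrakk>a \<in> carrier A; b \<in> carrier A; c \<in> carrier A\<rbrakk> \<Longrightarrow>
      (a \<oplus>\<^bsub>A\<^esub> b) \<otimes>\<^bsub>A\<^esub> c = a \<otimes>\<^bsub>A\<^esub> c \<oplus>\<^bsub>A\<^esub> b \<otimes>\<^bsub>A\<^esub> c"
    and mult_r_distr: "\<lbrakk>a \<in> carrier A; b \<in> carrier A; c \<in> carrier A\<rbrakk> \<Longrightarrow>
      a \<otimes>\<^bsub>A\<^esub> (b \<oplus>\<^bsub>A\<^esub> c) = a \<otimes>\<^bsub>A\<^esub> b \<oplus>\<^bsub>A\<^esub> a \<otimes>\<^bsub>A\<^esub> c"
    and mult_smult_left: "\<lbrakk>k \<in> carrier F; a \<in> carrier A; b \<in> carrier A\<rbrakk> \<Longrightarrow>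
      (k \<odot>\<^bsub>A\<^esub> a) \<otimes>\<^bsub>A\<^esub> b = k \<odot>\<^bsub>A\<^esub> (a \<otimes>\<^bsub>A\<^esub> b)"
    and mult_smult_right: "\<lbrakk>k \<in> carrier F; a \<in> carrier A; b \<in> carrier A\<rbrakk> \<Longrightarrow>
      a \<otimes>\<^bsub>A\<^esub> (k \<odot>\<^bsub>A\<^esub> b) = k \<odot>\<^bsub>A\<^esub> (a \<otimes>\<^bsub>A\<^esub> b)"
    and mult_assoc: "\<lbrakk>a \<in> carrier A; b \<in> carrier A; c \<in> carrier A\<rbrakk> \<Longrightarrow>
      (a \<otimes>\<^bsub>A\<^esub> b) \<otimes>\<^bsub>A\<^esub> c = a \<otimes>\<^bsub>A\<^esub> (b \<otimes>\<^bsub>A\<^esub> c)"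

text \<open>Negatives come from scaling by minus one. With this the coset lemmas for abelian
  subgroups apply to ideals.\<close>

lemma (in module) submodule_abelian_subgroup:
  assumes N: "submodule R N M"
  shows "abelian_subgroup N M"
proof (rule abelian_subgroupI3)
  show "abelian_group M" ..
  have NM: "N \<subseteq> carrier M" by (rule submodule.subset[OF N])
  have "\<ominus>\<^bsub>M\<^esub> x \<in> N" if "x \<in> N" for x
    using submodule.smult_closed[OF N _ that, of "\<ominus> \<one>"] smult_minus_1[of x] that NM by auto
  then show "additive_subgroup N M"
    using NM submodule.m_closed[OF N] submodule.zero_closed[OF N]
    by (intro additive_subgroupI add.subgroupI) (auto simp: a_inv_def)
qed

locale algebra_with_ideal = nonunital_algebra +
  fixes I
  assumes ideal: "algebra_ideal F A I"
begin

lemma ideal_submodule: "submodule F I A"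
  using ideal unfolding algebra_ideal_def by simp

sublocale I: abelian_subgroup I A
  by (rule submodule_abelian_subgroup[OF ideal_submodule])

lemma ideal_mult_left: "a \<in> carrier A \<Longrightarrow> x \<in> I \<Longrightarrow> a \<otimes>\<^bsub>A\<^esub> x \<in> I"
  using ideal unfolding algebra_ideal_def by simp

lemma ideal_mult_right: "a \<in> carrier A \<Longrightarrow> x \<in> I \<Longrightarrow> x \<otimes>\<^bsub>A\<^esub> a \<in> I"
  using ideal unfolding algebra_ideal_def by simp

abbreviation Q where "Q \<equiv> quotient_algebra A I"

abbreviation cls where "cls a \<equiv> I +>\<^bsub>A\<^esub> a"

lemma in_cls_iff: "x \<in> cls a \<longleftrightarrow> (\<exists>i\<in>I. x = i \<oplus>\<^bsub>A\<^esub> a)"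
  by (auto simp: a_r_coset_def')

lemma cls_eqI: "a \<in> carrier A \<Longrightarrow> i \<in> I \<Longrightarrow> x = i \<oplus>\<^bsub>A\<^esub> a \<Longrightarrow> cls x = cls a"
  using I.a_repr_independence'[of x a] in_cls_iff by blast

lemma cls_eq_iff:
  assumes "a \<in> carrier A" "b \<in> carrier A"
  shows "cls a = cls b \<longleftrightarrow> a \<ominus>\<^bsub>A\<^esub> b \<in> I"
proof
  assume "cls a = cls b"
  then have "a \<in> cls b" using I.a_rcos_self[OF assms(1)] by simp
  then show "a \<ominus>\<^bsub>A\<^esub> b \<in> I"
    using I.a_rcos_module[OF assms(2,1)] by (simp add: a_minus_def)
next
  assume "a \<ominus>\<^bsub>A\<^esub> b \<in> I"
  then have "a \<in> cls b"
    using I.a_rcos_module[OF assms(2,1)] by (simp add: a_minus_def)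
  then show "cls a = cls b"
    using I.a_repr_independence'[of a b] assms by simp
qed

lemma quotient_carrier: "carrier Q = cls ` carrier A"
  by (auto simp: quotient_algebra_def A_RCOSETS_def')

lemma cls_closed [simp]: "a \<in> carrier A \<Longrightarrow> cls a \<in> carrier Q"
  by (simp add: quotient_carrier)

lemma quotient_cases [consumes 1, case_names cls]:
  assumes "X \<in> carrier Q"
  obtains a where "a \<in> carrier A" "X = cls a"
  using assms by (auto simp: quotient_carrier)

lemma quotient_zero: "\<zero>\<^bsub>Q\<^esub> = cls \<zero>\<^bsub>A\<^esub>"
  by (simp add: quotient_algebra_def I.a_rcos_const)

lemma quotient_add:
  "a \<in> carrier A \<Longrightarrow> b \<in> carrier A \<Longrightarrow> cls a \<oplus>\<^bsub>Q\<^esub> cls b = cls (a \<oplus>\<^bsub>A\<^esub> b)"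
  by (simp add: quotient_algebra_def I.a_rcos_sum)

lemma quotient_mult:
  assumes a: "a \<in> carrier A" and b: "b \<in> carrier A"
  shows "cls a \<otimes>\<^bsub>Q\<^esub> cls b = cls (a \<otimes>\<^bsub>A\<^esub> b)"
proof -
  \<comment> \<open>The product of two cosets is a union over all pairs of representatives; it is a
    single coset because every pair yields the same one.\<close>
  have eq: "cls (x \<otimes>\<^bsub>A\<^esub> y) = cls (a \<otimes>\<^bsub>A\<^esub> b)" if "x \<in> cls a" "y \<in> cls b" for x y
  proof -
    obtain i j where ij: "i \<in> I" "x = i \<oplus>\<^bsub>A\<^esub> a" "j \<in> I" "y = j \<oplus>\<^bsub>A\<^esub> b"
      using \<open>x \<in> cls a\<close> \<open>y \<in> cls b\<close> in_cls_iff by blast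
    then have y: "y \<in> carrier A" using b by simp
    have "x \<otimes>\<^bsub>A\<^esub> y = (i \<otimes>\<^bsub>A\<^esub> y \<oplus>\<^bsub>A\<^esub> a \<otimes>\<^bsub>A\<^esub> j) \<oplus>\<^bsub>A\<^esub> a \<otimes>\<^bsub>A\<^esub> b"
      using ij a b y by (simp add: mult_l_distr mult_r_distr M.a_assoc M.a_lcomm)
    moreover have "i \<otimes>\<^bsub>A\<^esub> y \<oplus>\<^bsub>A\<^esub> a \<otimes>\<^bsub>A\<^esub> j \<in> I"
      using ij a y by (simp add: ideal_mult_left ideal_mult_right)
    ultimately show ?thesis using a b by (intro cls_eqI) auto
  qed
  have "cls a \<noteq> {}" "cls b \<noteq> {}" using a b I.a_rcos_self by blast+
  then have "(\<Union>x\<in>cls a. \<Union>y\<in>cls b. cls (x \<otimes>\<^bsub>A\<^esub> y)) = cls (a \<otimes>\<^bsub>A\<^esub> b)"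
    by (intro SUP_eq_const eq)
  then show ?thesis by (simp add: quotient_algebra_def rcoset_mult_def)
qed

lemma quotient_smult:
  assumes k: "k \<in> carrier F" and a: "a \<in> carrier A"
  shows "k \<odot>\<^bsub>Q\<^esub> cls a = cls (k \<odot>\<^bsub>A\<^esub> a)"
proof -
  have eq: "cls (k \<odot>\<^bsub>A\<^esub> x) = cls (k \<odot>\<^bsub>A\<^esub> a)" if x: "x \<in> cls a" for x
  proof -
    obtain i where i: "i \<in> I" "x = i \<oplus>\<^bsub>A\<^esub> a"
      using x in_cls_iff by blast
    then have "k \<odot>\<^bsub>A\<^esub> x = k \<odot>\<^bsub>A\<^esub> i \<oplus>\<^bsub>A\<^esub> k \<odot>\<^bsub>A\<^esub> a"
      using k a by (simp add: smult_r_distr)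
    then show ?thesis
      using k a i submodule.smult_closed[OF ideal_submodule k] by (intro cls_eqI) auto
  qed
  have "cls a \<noteq> {}" using a I.a_rcos_self by blast
  then have "(\<Union>x\<in>cls a. cls (k \<odot>\<^bsub>A\<^esub> x)) = cls (k \<odot>\<^bsub>A\<^esub> a)"
    by (intro SUP_eq_const eq)
  then show ?thesis by (simp add: quotient_algebra_def)
qed

lemmas quotient_simps = quotient_zero quotient_add quotient_mult quotient_smult

lemma quotient_abelian_group: "abelian_group Q"
proof (rule abelian_groupI)
  fix X Y Z assume "X \<in> carrier Q" "Y \<in> carrier Q" "Z \<in> carrier Q"
  then show "X \<oplus>\<^bsub>Q\<^esub> Y \<oplus>\<^bsub>Q\<^esub> Z = X \<oplus>\<^bsub>Q\<^esub> (Y \<oplus>\<^bsub>Q\<^esub> Z)"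
    by (elim quotient_cases) (simp add: quotient_simps M.a_assoc)
next
  fix X Y assume "X \<in> carrier Q" "Y \<in> carrier Q"
  then show "X \<oplus>\<^bsub>Q\<^esub> Y = Y \<oplus>\<^bsub>Q\<^esub> X" and "X \<oplus>\<^bsub>Q\<^esub> Y \<in> carrier Q"
    by (elim quotient_cases; simp add: quotient_simps M.a_comm)+
next
  fix X assume "X \<in> carrier Q"
  then show "\<zero>\<^bsub>Q\<^esub> \<oplus>\<^bsub>Q\<^esub> X = X"
    by (elim quotient_cases) (simp add: quotient_simps)
  from \<open>X \<in> carrier Q\<close> obtain a where a: "a \<in> carrier A" "X = cls a" by (rule quotient_cases)
  then show "\<exists>Y\<in>carrier Q. Y \<oplus>\<^bsub>Q\<^esub> X = \<zero>\<^bsub>Q\<^esub>"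
    by (intro bexI[of _ "cls (\<ominus>\<^bsub>A\<^esub> a)"]) (simp_all add: quotient_simps M.l_neg)
qed (simp add: quotient_zero)

lemma quotient_module: "module F Q"
proof (rule moduleI)
  show "cring F" ..
  show "abelian_group Q" by (rule quotient_abelian_group)
qed (elim quotient_cases; simp add: quotient_simps smult_l_distr smult_r_distr smult_assoc1)+

lemma quotient_nonunital_algebra: "nonunital_algebra F Q"
proof (intro nonunital_algebra.intro quotient_module nonunital_algebra_axioms.intro)
qed (elim quotient_cases; simp add: quotient_simps mult_l_distr mult_r_distr mult_smult_left
    mult_smult_right mult_assoc)+

end

text \<open>Keeps the family intersected in \<open>ideal_generated\<close> nonempty, so that the
  generated ideal stays inside the carrier.\<close>

lemma (in nonunital_algebra) algebra_ideal_carrier: "algebra_ideal F A (carrier A)"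
  unfolding algebra_ideal_def by (auto intro!: submodule.intro module_axioms)

lemma (in nonunital_algebra) algebra_ideal_generated:
  assumes "S \<subseteq> carrier A"
  shows "algebra_ideal F A (ideal_generated F A S)"
proof -
  have sub: "submodule F J A" if "algebra_ideal F A J" for J
    using that unfolding algebra_ideal_def by simp
  have mem: "x \<in> ideal_generated F A S \<longleftrightarrow> (\<forall>J. algebra_ideal F A J \<and> S \<subseteq> J \<longrightarrow> x \<in> J)" for x
    unfolding ideal_generated_def by blast
  have "submodule F (ideal_generated F A S) A"
  proof (rule submodule.intro)
    show "module F A" by (rule module_axioms)
    show "ideal_generated F A S \<subseteq> carrier A"
      using mem algebra_ideal_carrier assms by blast
    show "\<zero>\<^bsub>A\<^esub> \<in> ideal_generated F A S"
      using submodule.zero_closed[OF sub] by (simp add: mem)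
  qed (use submodule.m_closed[OF sub] submodule.smult_closed[OF sub] in \<open>simp_all add: mem\<close>)
  moreover have "a \<otimes>\<^bsub>A\<^esub> x \<in> ideal_generated F A S \<and> x \<otimes>\<^bsub>A\<^esub> a \<in> ideal_generated F A S"
    if "a \<in> carrier A" "x \<in> ideal_generated F A S" for a x
    using that by (simp add: mem algebra_ideal_def)
  ultimately show ?thesis unfolding algebra_ideal_def by blast
qed

lemma ideal_generated_superset: "S \<subseteq> ideal_generated F A S"
  unfolding ideal_generated_def by blast

lemma ideal_generated_least: "algebra_ideal F A I \<Longrightarrow> S \<subseteq> I \<Longrightarrow> ideal_generated F A S \<subseteq> I"
  unfolding ideal_generated_def by blast

section \<open>Free algebras and their modules\<close>

abbreviation supp :: "('k, 'r) ring_scheme \<Rightarrow> ('a \<Rightarrow> 'k) \<Rightarrow> 'a set" where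
  "supp F f \<equiv> {w. f w \<noteq> \<zero>\<^bsub>F\<^esub>}"

definition words :: "'x set \<Rightarrow> 'x list set" where
  "words X = {w. w \<noteq> [] \<and> set w \<subseteq> X}"

lemma free_algebra_carrier_iff:
  "f \<in> carrier (free_algebra F X) \<longleftrightarrow>
    (\<forall>w. f w \<in> carrier F) \<and> finite (supp F f) \<and> supp F f \<subseteq> words X"
  by (auto simp: free_algebra_def words_def)

context cring
begin

lemma free_algebra_add: "(f \<oplus>\<^bsub>free_algebra R X\<^esub> g) w = f w \<oplus> g w"
  by (simp add: free_algebra_def)

lemma free_algebra_smult: "(c \<odot>\<^bsub>free_algebra R X\<^esub> f) w = c \<otimes> f w"
  by (simp add: free_algebra_def)

lemma free_algebra_zero: "\<zero>\<^bsub>free_algebra R X\<^esub> w = \<zero>"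
  by (simp add: free_algebra_def)

lemma free_algebra_mult:
  "(f \<otimes>\<^bsub>free_algebra R X\<^esub> g) w = (\<Oplus>i\<in>{..length w}. f (take i w) \<otimes> g (drop i w))"
  by (simp add: free_algebra_def)

lemma free_algebra_mult_closed:
  assumes f: "f \<in> carrier (free_algebra R X)" and g: "g \<in> carrier (free_algebra R X)"
  shows "f \<otimes>\<^bsub>free_algebra R X\<^esub> g \<in> carrier (free_algebra R X)"
proof -
  have fR: "f w \<in> carrier R" and gR: "g w \<in> carrier R" for w
    using f g by (auto simp: free_algebra_carrier_iff)
  have supp: "supp R (f \<otimes>\<^bsub>free_algebra R X\<^esub> g) \<subseteq> (\<lambda>(u, v). u @ v) ` (supp R f \<times> supp R g)"
  proof
    fix w assume w: "w \<in> supp R (f \<otimes>\<^bsub>free_algebra R X\<^esub> g)"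
    have "\<exists>i. f (take i w) \<otimes> g (drop i w) \<noteq> \<zero>"
    proof (rule ccontr)
      assume "\<nexists>i. f (take i w) \<otimes> g (drop i w) \<noteq> \<zero>"
      then have "(\<Oplus>i\<in>{..length w}. f (take i w) \<otimes> g (drop i w)) = \<zero>"
        by (intro add.finprod_one_eqI) auto
      then show False using w by (simp add: free_algebra_mult)
    qed
    then obtain i where "f (take i w) \<otimes> g (drop i w) \<noteq> \<zero>" by blast
    then have "take i w \<in> supp R f" "drop i w \<in> supp R g" using fR gR by auto
    then show "w \<in> (\<lambda>(u, v). u @ v) ` (supp R f \<times> supp R g)"
      by (intro image_eqI[of _ _ "(take i w, drop i w)"]) auto
  qed
  moreover have "(\<lambda>(u, v). u @ v) ` (supp R f \<times> supp R g) \<subseteq> words X"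
    using f g by (fastforce simp: free_algebra_carrier_iff words_def)
  moreover have "finite (supp R f \<times> supp R g)"
    using f g by (simp add: free_algebra_carrier_iff)
  ultimately show ?thesis
    using fR gR by (auto simp: free_algebra_carrier_iff free_algebra_mult intro: finite_subset)
qed

lemma free_algebra_module: "module R (free_algebra R X)"
proof -
  have add: "f \<oplus>\<^bsub>free_algebra R X\<^esub> g \<in> carrier (free_algebra R X)"
    if "f \<in> carrier (free_algebra R X)" "g \<in> carrier (free_algebra R X)" for f g
  proof -
    have "supp R (f \<oplus>\<^bsub>free_algebra R X\<^esub> g) \<subseteq> supp R f \<union> supp R g"
      using that by (auto simp: free_algebra_carrier_iff free_algebra_add)
    then show ?thesis
      using that by (auto simp: free_algebra_carrier_iff free_algebra_add intro: finite_subset)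
  qed
  have smult: "c \<odot>\<^bsub>free_algebra R X\<^esub> f \<in> carrier (free_algebra R X)"
    if "c \<in> carrier R" "f \<in> carrier (free_algebra R X)" for c f
  proof -
    have "supp R (c \<odot>\<^bsub>free_algebra R X\<^esub> f) \<subseteq> supp R f"
      using that by (auto simp: free_algebra_carrier_iff free_algebra_smult)
    then show ?thesis
      using that by (auto simp: free_algebra_carrier_iff free_algebra_smult intro: finite_subset)
  qed
  have "abelian_group (free_algebra R X)"
  proof (rule abelian_groupI)
    fix f g assume "f \<in> carrier (free_algebra R X)" "g \<in> carrier (free_algebra R X)"
    then show "f \<oplus>\<^bsub>free_algebra R X\<^esub> g \<in> carrier (free_algebra R X)" by (rule add)
  next
    fix f assume f: "f \<in> carrier (free_algebra R X)"
    then show "\<exists>g\<in>carrier (free_algebra R X). g \<oplus>\<^bsub>free_algebra R X\<^esub> f = \<zero>\<^bsub>free_algebra R X\<^esub>"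
      by (intro bexI[of _ "(\<ominus> \<one>) \<odot>\<^bsub>free_algebra R X\<^esub> f"])
        (auto intro!: smult ext
          simp: free_algebra_add free_algebra_smult free_algebra_zero l_minus l_neg free_algebra_carrier_iff)
  qed (auto intro!: ext
      simp: free_algebra_carrier_iff free_algebra_add free_algebra_zero a_ac)
  then show ?thesis
  proof (rule moduleI[OF is_cring])
    fix c f assume "c \<in> carrier R" "f \<in> carrier (free_algebra R X)"
    then show "c \<odot>\<^bsub>free_algebra R X\<^esub> f \<in> carrier (free_algebra R X)" by (rule smult)
  qed (auto intro!: ext simp: free_algebra_carrier_iff free_algebra_add free_algebra_smult
      l_distr r_distr m_assoc)
qed

lemma monomial_closed: "w \<in> words X \<Longrightarrow> monomial R w \<in> carrier (free_algebra R X)"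
  by (auto simp: free_algebra_carrier_iff monomial_def intro: finite_subset[of _ "{w}"])

lemma monomial_mult: "monomial R u \<otimes>\<^bsub>free_algebra R X\<^esub> monomial R v = monomial R (u @ v)"
proof
  fix w
  \<comment> \<open>Among all cuts of \<open>w\<close>, only the one after \<open>length u\<close>
    letters can match \<open>u\<close>; it contributes exactly when the rest is
    \<open>v\<close>.\<close>
  have "monomial R u (take i w) \<otimes> monomial R v (drop i w)
      = (if length u = i then if w = u @ v then \<one> else \<zero> else \<zero>)"
    if "i \<in> {..length w}" for i
  proof (cases "take i w = u \<and> drop i w = v")
    case True
    then have "w = u @ v" and "length u = i"
      using that by (metis append_take_drop_id, auto)
    then show ?thesis using True that by (auto simp: monomial_def)
  next
    case False
    then have "\<not> (length u = i \<and> w = u @ v)" by auto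
    then show ?thesis using False by (auto simp: monomial_def)
  qed
  then have "(monomial R u \<otimes>\<^bsub>free_algebra R X\<^esub> monomial R v) w
      = (\<Oplus>i\<in>{..length w}. if length u = i then if w = u @ v then \<one> else \<zero> else \<zero>)"
    unfolding free_algebra_mult by (intro add.finprod_cong') auto
  also have "\<dots> = monomial R (u @ v) w"
  proof (cases "w = u @ v")
    case True
    then show ?thesis
      using add.finprod_singleton[of "length u" "{..length w}" "\<lambda>_. \<one>"] by (simp add: monomial_def)
  next
    case False
    then show ?thesis by (simp add: monomial_def)
  qed
  finally show "(monomial R u \<otimes>\<^bsub>free_algebra R X\<^esub> monomial R v) w = monomial R (u @ v) w" .
qed

text \<open>Words are peeled one by one off a finite set containing the support. The rule reduces
  multilinear identities to monomials.\<close>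

lemma free_algebra_induct [consumes 1, case_names zero add smult monomial]:
  assumes f: "f \<in> carrier (free_algebra R X)"
    and zero: "P \<zero>\<^bsub>free_algebra R X\<^esub>"
    and add: "\<And>f g. f \<in> carrier (free_algebra R X) \<Longrightarrow> g \<in> carrier (free_algebra R X) \<Longrightarrow>
      P f \<Longrightarrow> P g \<Longrightarrow> P (f \<oplus>\<^bsub>free_algebra R X\<^esub> g)"
    and smult: "\<And>c f. c \<in> carrier R \<Longrightarrow> f \<in> carrier (free_algebra R X) \<Longrightarrow> P f \<Longrightarrow>
      P (c \<odot>\<^bsub>free_algebra R X\<^esub> f)"
    and mon: "\<And>w. w \<in> words X \<Longrightarrow> P (monomial R w)"
  shows "P f"
proof -
  interpret A: module R "free_algebra R X" by (rule free_algebra_module)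
  have "P f" if "finite S" "supp R f \<subseteq> S" "f \<in> carrier (free_algebra R X)" for S f
    using that
  proof (induct S arbitrary: f)
    case empty
    then have "f = \<zero>\<^bsub>free_algebra R X\<^esub>" by (auto simp: free_algebra_zero)
    then show ?case using zero by simp
  next
    case (insert w S)
    show ?case
    proof (cases "f w = \<zero>")
      case True
      then show ?thesis using insert by (intro insert.hyps(3)) auto
    next
      case False
      then have w: "w \<in> words X" using insert.prems by (auto simp: free_algebra_carrier_iff)
      let ?g = "f(w := \<zero>)"
      have "supp R ?g \<subseteq> supp R f" by auto
      then have g: "?g \<in> carrier (free_algebra R X)"
        using insert.prems(2) by (auto simp: free_algebra_carrier_iff intro: finite_subset)
      have fw: "f w \<in> carrier R" using insert.prems by (simp add: free_algebra_carrier_iff)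
      have "f = f w \<odot>\<^bsub>free_algebra R X\<^esub> monomial R w \<oplus>\<^bsub>free_algebra R X\<^esub> ?g"
        using insert.prems fw
        by (auto simp: free_algebra_carrier_iff free_algebra_add free_algebra_smult monomial_def)
      moreover have "P ?g"
        using insert.prems(1) by (intro insert.hyps(3)[OF _ g]) auto
      ultimately show ?thesis
        using add[OF _ g smult[OF fw _ mon[OF w]]] monomial_closed[OF w] fw by auto
    qed
  qed
  then show ?thesis using f by (auto simp: free_algebra_carrier_iff)
qed

lemma free_algebra_nonunital_algebra: "nonunital_algebra R (free_algebra R X)"
proof -
  let ?A = "free_algebra R X"
  interpret A: module R ?A by (rule free_algebra_module)
  have val: "f w \<in> carrier R" if "f \<in> carrier ?A" for f w
    using that by (simp add: free_algebra_carrier_iff)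
  note [simp] = free_algebra_mult_closed
  have l_distr: "(f \<oplus>\<^bsub>?A\<^esub> g) \<otimes>\<^bsub>?A\<^esub> h = f \<otimes>\<^bsub>?A\<^esub> h \<oplus>\<^bsub>?A\<^esub> g \<otimes>\<^bsub>?A\<^esub> h"
    if "f \<in> carrier ?A" "g \<in> carrier ?A" "h \<in> carrier ?A" for f g h
    by (rule ext) (simp add: free_algebra_mult free_algebra_add l_distr val that
        flip: finsum_addf)
  have r_distr: "h \<otimes>\<^bsub>?A\<^esub> (f \<oplus>\<^bsub>?A\<^esub> g) = h \<otimes>\<^bsub>?A\<^esub> f \<oplus>\<^bsub>?A\<^esub> h \<otimes>\<^bsub>?A\<^esub> g"
    if "f \<in> carrier ?A" "g \<in> carrier ?A" "h \<in> carrier ?A" for f g h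
    by (rule ext) (simp add: free_algebra_mult free_algebra_add r_distr val that
        flip: finsum_addf)
  have smult_l: "(c \<odot>\<^bsub>?A\<^esub> f) \<otimes>\<^bsub>?A\<^esub> g = c \<odot>\<^bsub>?A\<^esub> (f \<otimes>\<^bsub>?A\<^esub> g)"
    if "c \<in> carrier R" "f \<in> carrier ?A" "g \<in> carrier ?A" for c f g
    by (rule ext) (simp add: free_algebra_mult free_algebra_smult finsum_rdistr val that m_assoc)
  have smult_r: "f \<otimes>\<^bsub>?A\<^esub> (c \<odot>\<^bsub>?A\<^esub> g) = c \<odot>\<^bsub>?A\<^esub> (f \<otimes>\<^bsub>?A\<^esub> g)"
    if "c \<in> carrier R" "f \<in> carrier ?A" "g \<in> carrier ?A" for c f g
    by (rule ext) (simp add: free_algebra_mult free_algebra_smult finsum_rdistr val that m_lcomm)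
  have zero_l: "\<zero>\<^bsub>?A\<^esub> \<otimes>\<^bsub>?A\<^esub> f = \<zero>\<^bsub>?A\<^esub>" and zero_r: "f \<otimes>\<^bsub>?A\<^esub> \<zero>\<^bsub>?A\<^esub> = \<zero>\<^bsub>?A\<^esub>"
    if "f \<in> carrier ?A" for f
    using that by (auto simp: free_algebra_mult free_algebra_zero val)
  note simps = l_distr r_distr smult_l smult_r zero_l zero_r A.smult_r_distr monomial_closed
  \<comment> \<open>Trilinearity leaves only monomials, where the claim is associativity of list
    concatenation; no double sum over cuts has to be reindexed.\<close>
  have assoc: "f \<otimes>\<^bsub>?A\<^esub> g \<otimes>\<^bsub>?A\<^esub> h = f \<otimes>\<^bsub>?A\<^esub> (g \<otimes>\<^bsub>?A\<^esub> h)"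
    if f: "f \<in> carrier ?A" and g: "g \<in> carrier ?A" and h: "h \<in> carrier ?A" for f g h
    using f
  proof (induct f rule: free_algebra_induct)
    case f: (monomial u)
    show ?case using g
    proof (induct g rule: free_algebra_induct)
      case g: (monomial v)
      show ?case using h
      proof (induct h rule: free_algebra_induct)
        case (monomial w)
        then show ?case by (simp add: monomial_mult)
      qed (use f g in \<open>simp_all add: simps\<close>)
    qed (use f h in \<open>simp_all add: simps\<close>)
  qed (use g h in \<open>simp_all add: simps\<close>)
  show ?thesis
    by (intro nonunital_algebra.intro nonunital_algebra_axioms.intro free_algebra_module)
      (use l_distr r_distr smult_l smult_r assoc in auto)
qed

end

section \<open>Modules over free algebras from families of operators\<close>

locale operator_family = module R M for R and M (structure) +
  fixes X :: "'x set" and T :: "'x \<Rightarrow> 'c \<Rightarrow> 'c"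
  assumes op_closed: "g \<in> X \<Longrightarrow> x \<in> carrier M \<Longrightarrow> T g x \<in> carrier M"
    and op_add: "g \<in> X \<Longrightarrow> x \<in> carrier M \<Longrightarrow> y \<in> carrier M \<Longrightarrow>
      T g (x \<oplus>\<^bsub>M\<^esub> y) = T g x \<oplus>\<^bsub>M\<^esub> T g y"
    and op_smult: "g \<in> X \<Longrightarrow> c \<in> carrier R \<Longrightarrow> x \<in> carrier M \<Longrightarrow>
      T g (c \<odot>\<^bsub>M\<^esub> x) = c \<odot>\<^bsub>M\<^esub> T g x"
begin

sublocale A: nonunital_algebra R "free_algebra R X"
  by (rule R.free_algebra_nonunital_algebra)

text \<open>The fold runs from the left because the modules are right modules: the first letter of a
  word acts first.\<close>

definition word_act where "word_act x w = foldl (\<lambda>x g. T g x) x w"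

text \<open>The universal property of the free algebra: linear operators chosen freely for the
  generators extend to a right action. Relations enter later, through the annihilator.\<close>

definition free_act where
  "free_act x f = (\<Oplus>\<^bsub>M\<^esub>w\<in>supp R f. f w \<odot>\<^bsub>M\<^esub> word_act x w)"

lemma word_act_simps [simp]:
  "word_act x [] = x" "word_act x (g # w) = word_act (T g x) w"
  "word_act x (v @ w) = word_act (word_act x v) w"
  by (simp_all add: word_act_def)

lemma word_act_closed [simp]: "set w \<subseteq> X \<Longrightarrow> x \<in> carrier M \<Longrightarrow> word_act x w \<in> carrier M"
  by (induct w arbitrary: x) (auto simp: op_closed)

lemma word_act_add: "set w \<subseteq> X \<Longrightarrow> x \<in> carrier M \<Longrightarrow> y \<in> carrier M \<Longrightarrow>
    word_act (x \<oplus>\<^bsub>M\<^esub> y) w = word_act x w \<oplus>\<^bsub>M\<^esub> word_act y w"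
  by (induct w arbitrary: x y) (auto simp: op_closed op_add)

lemma word_act_smult: "set w \<subseteq> X \<Longrightarrow> c \<in> carrier R \<Longrightarrow> x \<in> carrier M \<Longrightarrow>
    word_act (c \<odot>\<^bsub>M\<^esub> x) w = c \<odot>\<^bsub>M\<^esub> word_act x w"
  by (induct w arbitrary: x) (auto simp: op_closed op_smult)

lemma words_set: "w \<in> words X \<Longrightarrow> set w \<subseteq> X"
  by (simp add: words_def)

text \<open>Widening the index set beyond the support lets the sums for two elements run over a
  common set.\<close>

lemma free_act_superset:
  assumes "x \<in> carrier M" "finite S" "supp R f \<subseteq> S" "S \<subseteq> words X" "\<And>w. f w \<in> carrier R"
  shows "free_act x f = (\<Oplus>\<^bsub>M\<^esub>w\<in>S. f w \<odot>\<^bsub>M\<^esub> word_act x w)"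
  unfolding free_act_def
  using assms words_set by (intro M.add.finprod_mono_neutral_cong_left) auto

lemma free_act_terms:
  assumes "x \<in> carrier M" "f \<in> carrier (free_algebra R X)" "S \<subseteq> words X"
  shows "(\<lambda>w. f w \<odot>\<^bsub>M\<^esub> word_act x w) \<in> S \<rightarrow> carrier M"
  using assms words_set by (auto simp: free_algebra_carrier_iff)

lemma free_act_closed [simp]:
  assumes "x \<in> carrier M" "f \<in> carrier (free_algebra R X)"
  shows "free_act x f \<in> carrier M"
  unfolding free_act_def using assms
  by (intro M.finsum_closed free_act_terms) (simp_all add: free_algebra_carrier_iff)

lemma free_act_zero: "x \<in> carrier M \<Longrightarrow> free_act x \<zero>\<^bsub>free_algebra R X\<^esub> = \<zero>\<^bsub>M\<^esub>"
  by (simp add: free_act_def R.free_algebra_zero)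

lemma free_act_add_right:
  assumes x: "x \<in> carrier M" and f: "f \<in> carrier (free_algebra R X)" and g: "g \<in> carrier (free_algebra R X)"
  shows "free_act x (f \<oplus>\<^bsub>free_algebra R X\<^esub> g) = free_act x f \<oplus>\<^bsub>M\<^esub> free_act x g"
proof -
  let ?S = "supp R f \<union> supp R g"
  have S: "finite ?S" "?S \<subseteq> words X" using f g by (auto simp: free_algebra_carrier_iff)
  have val: "f w \<in> carrier R" "g w \<in> carrier R" for w
    using f g by (auto simp: free_algebra_carrier_iff)
  have "free_act x (f \<oplus>\<^bsub>free_algebra R X\<^esub> g)
      = (\<Oplus>\<^bsub>M\<^esub>w\<in>?S. (f w \<oplus>\<^bsub>R\<^esub> g w) \<odot>\<^bsub>M\<^esub> word_act x w)"
  proof -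
    have "supp R (\<lambda>w. f w \<oplus>\<^bsub>R\<^esub> g w) \<subseteq> ?S" by auto
    then show ?thesis
      using free_act_superset[OF x S(1) _ S(2), of "f \<oplus>\<^bsub>free_algebra R X\<^esub> g"] val
      by (simp add: R.free_algebra_add)
  qed
  also have "\<dots> = (\<Oplus>\<^bsub>M\<^esub>w\<in>?S. f w \<odot>\<^bsub>M\<^esub> word_act x w \<oplus>\<^bsub>M\<^esub> g w \<odot>\<^bsub>M\<^esub> word_act x w)"
    using S words_set val x by (intro M.add.finprod_cong') (auto simp: smult_l_distr)
  also have "\<dots> = (\<Oplus>\<^bsub>M\<^esub>w\<in>?S. f w \<odot>\<^bsub>M\<^esub> word_act x w) \<oplus>\<^bsub>M\<^esub> (\<Oplus>\<^bsub>M\<^esub>w\<in>?S. g w \<odot>\<^bsub>M\<^esub> word_act x w)"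
    by (intro M.finsum_addf free_act_terms x f g S)
  also have "\<dots> = free_act x f \<oplus>\<^bsub>M\<^esub> free_act x g"
    using free_act_superset[OF x S(1) _ S(2), of f] free_act_superset[OF x S(1) _ S(2), of g] val
    by simp
  finally show ?thesis .
qed

lemma free_act_smult_right:
  assumes x: "x \<in> carrier M" and f: "f \<in> carrier (free_algebra R X)" and c: "c \<in> carrier R"
  shows "free_act x (c \<odot>\<^bsub>free_algebra R X\<^esub> f) = c \<odot>\<^bsub>M\<^esub> free_act x f"
proof -
  let ?S = "supp R f"
  have S: "finite ?S" "?S \<subseteq> words X" using f by (auto simp: free_algebra_carrier_iff)
  have val: "f w \<in> carrier R" for w
    using f by (auto simp: free_algebra_carrier_iff)
  have "free_act x (c \<odot>\<^bsub>free_algebra R X\<^esub> f) = (\<Oplus>\<^bsub>M\<^esub>w\<in>?S. (c \<otimes>\<^bsub>R\<^esub> f w) \<odot>\<^bsub>M\<^esub> word_act x w)"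
  proof -
    have "supp R (\<lambda>w. c \<otimes>\<^bsub>R\<^esub> f w) \<subseteq> ?S" using c by auto
    then show ?thesis
      using free_act_superset[OF x S(1) _ S(2), of "c \<odot>\<^bsub>free_algebra R X\<^esub> f"] val c
      by (simp add: R.free_algebra_smult)
  qed
  also have "\<dots> = (\<Oplus>\<^bsub>M\<^esub>w\<in>?S. c \<odot>\<^bsub>M\<^esub> (f w \<odot>\<^bsub>M\<^esub> word_act x w))"
    using S words_set val x c by (intro M.add.finprod_cong') (auto simp: smult_assoc1)
  also have "\<dots> = c \<odot>\<^bsub>M\<^esub> free_act x f"
    unfolding free_act_def
    by (rule finsum_smult_ldistr[OF S(1) c free_act_terms[OF x f S(2)], symmetric])
  finally show ?thesis .
qed

lemma free_act_add_left:
  assumes x: "x \<in> carrier M" and y: "y \<in> carrier M" and f: "f \<in> carrier (free_algebra R X)"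
  shows "free_act (x \<oplus>\<^bsub>M\<^esub> y) f = free_act x f \<oplus>\<^bsub>M\<^esub> free_act y f"
proof -
  have S: "supp R f \<subseteq> words X" and val: "f w \<in> carrier R" for w
    using f by (auto simp: free_algebra_carrier_iff)
  have "free_act (x \<oplus>\<^bsub>M\<^esub> y) f
      = (\<Oplus>\<^bsub>M\<^esub>w\<in>supp R f. f w \<odot>\<^bsub>M\<^esub> word_act x w \<oplus>\<^bsub>M\<^esub> f w \<odot>\<^bsub>M\<^esub> word_act y w)"
    unfolding free_act_def using S words_set x y val
    by (intro M.add.finprod_cong') (auto simp: word_act_add smult_r_distr)
  also have "\<dots> = free_act x f \<oplus>\<^bsub>M\<^esub> free_act y f"
    unfolding free_act_def by (intro M.finsum_addf free_act_terms x y f S)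
  finally show ?thesis .
qed

lemma free_act_smult_left:
  assumes x: "x \<in> carrier M" and c: "c \<in> carrier R" and f: "f \<in> carrier (free_algebra R X)"
  shows "free_act (c \<odot>\<^bsub>M\<^esub> x) f = c \<odot>\<^bsub>M\<^esub> free_act x f"
proof -
  have S: "finite (supp R f)" "supp R f \<subseteq> words X" and val: "f w \<in> carrier R" for w
    using f by (auto simp: free_algebra_carrier_iff)
  have "free_act (c \<odot>\<^bsub>M\<^esub> x) f = (\<Oplus>\<^bsub>M\<^esub>w\<in>supp R f. c \<odot>\<^bsub>M\<^esub> (f w \<odot>\<^bsub>M\<^esub> word_act x w))"
    unfolding free_act_def using S words_set x c val
    by (intro M.add.finprod_cong') (auto simp: word_act_smult smult_assoc1[symmetric] R.m_comm)
  also have "\<dots> = c \<odot>\<^bsub>M\<^esub> free_act x f"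
    unfolding free_act_def
    by (rule finsum_smult_ldistr[OF S(1) c free_act_terms[OF x f S(2)], symmetric])
  finally show ?thesis .
qed

lemma free_act_monomial:
  assumes "w \<in> words X" "x \<in> carrier M"
  shows "free_act x (monomial R w) = word_act x w"
proof -
  have "supp R (monomial R w) \<subseteq> {w}" by (auto simp: monomial_def)
  then have "free_act x (monomial R w) = (\<Oplus>\<^bsub>M\<^esub>u\<in>{w}. monomial R w u \<odot>\<^bsub>M\<^esub> word_act x u)"
    using assms by (intro free_act_superset) (auto simp: monomial_def)
  then show ?thesis using assms words_set[OF assms(1)] by (simp add: monomial_def)
qed

lemma free_act_null: "f \<in> carrier (free_algebra R X) \<Longrightarrow> free_act \<zero>\<^bsub>M\<^esub> f = \<zero>\<^bsub>M\<^esub>"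
  using free_act_smult_left[of "\<zero>\<^bsub>M\<^esub>" "\<zero>\<^bsub>R\<^esub>" f] by simp

lemma free_act_mult:
  assumes x: "x \<in> carrier M" and f: "f \<in> carrier (free_algebra R X)" and g: "g \<in> carrier (free_algebra R X)"
  shows "free_act x (f \<otimes>\<^bsub>free_algebra R X\<^esub> g) = free_act (free_act x f) g"
proof -
  have zero_l: "\<zero>\<^bsub>free_algebra R X\<^esub> \<otimes>\<^bsub>free_algebra R X\<^esub> h = \<zero>\<^bsub>free_algebra R X\<^esub>"
    and zero_r: "h \<otimes>\<^bsub>free_algebra R X\<^esub> \<zero>\<^bsub>free_algebra R X\<^esub> = \<zero>\<^bsub>free_algebra R X\<^esub>"
    if "h \<in> carrier (free_algebra R X)" for h
    using A.mult_smult_left[of "\<zero>\<^bsub>R\<^esub>" "\<zero>\<^bsub>free_algebra R X\<^esub>" h]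
      A.mult_smult_right[of "\<zero>\<^bsub>R\<^esub>" h "\<zero>\<^bsub>free_algebra R X\<^esub>"] that by simp_all
  note simps = R.monomial_closed free_act_zero free_act_null free_act_add_left free_act_add_right
    free_act_smult_left free_act_smult_right A.mult_l_distr A.mult_r_distr
    A.mult_smult_left A.mult_smult_right zero_l zero_r
  show ?thesis using f
  proof (induct f rule: R.free_algebra_induct)
    case f: (monomial u)
    show ?case using g
    proof (induct g rule: R.free_algebra_induct)
      case (monomial v)
      then have "u @ v \<in> words X" using f by (auto simp: words_def)
      then show ?case using f monomial x words_set
        by (simp add: R.monomial_mult free_act_monomial)
    qed (use f x in \<open>simp_all add: simps\<close>)
  qed (use x g in \<open>simp_all add: simps\<close>)
qed

text \<open>As the annihilator is an ideal, an action that respects the defining relations respects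
  everything they generate.\<close>

lemma free_act_annihilator_ideal:
  "algebra_ideal R (free_algebra R X)
    {f \<in> carrier (free_algebra R X). \<forall>x\<in>carrier M. free_act x f = \<zero>\<^bsub>M\<^esub>}"
  unfolding algebra_ideal_def
  by (auto intro!: submodule.intro A.module_axioms
      simp: free_act_zero free_act_add_right free_act_smult_right free_act_mult free_act_null)

lemma free_act_finsum:
  assumes x: "x \<in> carrier M" and f: "f \<in> S \<rightarrow> carrier (free_algebra R X)"
  shows "free_act x (finsum (free_algebra R X) f S) = (\<Oplus>\<^bsub>M\<^esub>i\<in>S. free_act x (f i))"
  by (rule additive_finsum[OF A.M.abelian_group_axioms M.abelian_group_axioms])
    (use assms free_act_add_right in auto)

end

section \<open>Finite dimensional modules of Leavitt path algebras\<close>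

locale leavitt = field F + wf_digraph G
  for F :: "('k, 'r) ring_scheme" and G :: "('v, 'e) pre_digraph" +
  assumes row_finite: "row_finite G"
begin

abbreviation FA where "FA \<equiv> free_algebra F (generators G)"

abbreviation rels where "rels \<equiv> {x \<ominus>\<^bsub>FA\<^esub> y | x y. leavitt_rel F G x y}"

sublocale FA: nonunital_algebra F FA
  by (rule free_algebra_nonunital_algebra)

lemma generatorsI [simp]:
  "v \<in> verts G \<Longrightarrow> Vertex v \<in> generators G"
  "e \<in> arcs G \<Longrightarrow> Arrow e \<in> generators G"
  "e \<in> arcs G \<Longrightarrow> Ghost e \<in> generators G"
  by (auto simp: generators_def)

lemma words_generators [simp]:
  "[] \<notin> words (generators G)"
  "g # w \<in> words (generators G) \<longleftrightarrow> g \<in> generators G \<and> set w \<subseteq> generators G"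
  by (auto simp: words_def)

lemma finite_out_arcs: "finite (out_arcs G v)"
  using row_finite wellformed(1)
  by (cases "v \<in> verts G") (auto simp: row_finite_def out_arcs_def intro: finite_subset[of _ "{}"])

lemma leavitt_rel_closed:
  "leavitt_rel F G x y \<Longrightarrow> x \<in> carrier FA \<and> y \<in> carrier FA"
  by (induct rule: leavitt_rel.induct)
    (auto intro!: monomial_closed FA.M.finsum_closed)

sublocale L: algebra_with_ideal F FA "ideal_generated F FA rels"
proof (unfold_locales, rule FA.algebra_ideal_generated)
  show "rels \<subseteq> carrier FA" using leavitt_rel_closed by auto
qed

lemma leavitt_path_algebra_eq: "leavitt_path_algebra F G = L.Q"
  by (simp add: leavitt_path_algebra_def Let_def)

sublocale LA: nonunital_algebra F L.Q
  by (rule L.quotient_nonunital_algebra)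

lemma cls_rel: "leavitt_rel F G x y \<Longrightarrow> L.cls x = L.cls y"
  using leavitt_rel_closed[of x y] ideal_generated_superset[of rels F FA]
  by (subst L.cls_eq_iff) auto

abbreviation word where "word w \<equiv> L.cls (monomial F w)"

lemma word_closed: "w \<in> words (generators G) \<Longrightarrow> word w \<in> carrier L.Q"
  by (simp add: monomial_closed)

lemma word_mult: "u \<in> words (generators G) \<Longrightarrow> v \<in> words (generators G) \<Longrightarrow>
    word u \<otimes>\<^bsub>L.Q\<^esub> word v = word (u @ v)"
  by (simp add: L.quotient_mult monomial_closed monomial_mult)

lemma word_vertex_vertex:
  "v \<in> verts G \<Longrightarrow> w \<in> verts G \<Longrightarrow>
    word [Vertex v, Vertex w] = (if v = w then word [Vertex v] else \<zero>\<^bsub>L.Q\<^esub>)"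
  using cls_rel[OF leavitt_rel.V[of v G w F]] by (auto simp: L.quotient_zero)

lemma word_arrow_ghost:
  assumes "e \<in> arcs G"
  shows "word [Vertex (tail G e), Arrow e] = word [Arrow e]"
    and "word [Arrow e, Vertex (head G e)] = word [Arrow e]"
    and "word [Vertex (head G e), Ghost e] = word [Ghost e]"
    and "word [Ghost e, Vertex (tail G e)] = word [Ghost e]"
  using assms by (auto intro!: cls_rel leavitt_rel.intros)

lemma word_ghost_arrow:
  "e \<in> arcs G \<Longrightarrow> f \<in> arcs G \<Longrightarrow>
    word [Ghost e, Arrow f] = (if e = f then word [Vertex (head G e)] else \<zero>\<^bsub>L.Q\<^esub>)"
  using cls_rel[OF leavitt_rel.CK1[of e G f F]] by (auto simp: L.quotient_zero)

lemma L_zero_mult: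
  assumes "a \<in> carrier L.Q"
  shows "\<zero>\<^bsub>L.Q\<^esub> \<otimes>\<^bsub>L.Q\<^esub> a = \<zero>\<^bsub>L.Q\<^esub>" and "a \<otimes>\<^bsub>L.Q\<^esub> \<zero>\<^bsub>L.Q\<^esub> = \<zero>\<^bsub>L.Q\<^esub>"
  using assms LA.mult_smult_left[of "\<zero>\<^bsub>F\<^esub>" "\<zero>\<^bsub>L.Q\<^esub>" a] LA.mult_smult_right[of "\<zero>\<^bsub>F\<^esub>" a "\<zero>\<^bsub>L.Q\<^esub>"] by simp_all

lemma L_induct [consumes 1, case_names zero add smult word]:
  assumes a: "a \<in> carrier L.Q"
    and zero: "P \<zero>\<^bsub>L.Q\<^esub>"
    and add: "\<And>a b. a \<in> carrier L.Q \<Longrightarrow> b \<in> carrier L.Q \<Longrightarrow> P a \<Longrightarrow> P b \<Longrightarrow> P (a \<oplus>\<^bsub>L.Q\<^esub> b)"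
    and smult: "\<And>c a. c \<in> carrier F \<Longrightarrow> a \<in> carrier L.Q \<Longrightarrow> P a \<Longrightarrow> P (c \<odot>\<^bsub>L.Q\<^esub> a)"
    and word: "\<And>w. w \<in> words (generators G) \<Longrightarrow> P (word w)"
  shows "P a"
proof -
  have "P (L.cls f)" if "f \<in> carrier FA" for f
    using that
  proof (induct f rule: free_algebra_induct)
    case zero
    then show ?case using assms(2) by (simp add: L.quotient_zero)
  next
    case (add f g)
    then show ?case using assms(3)[of "L.cls f" "L.cls g"] by (simp add: L.quotient_add)
  next
    case (smult c f)
    then show ?case using assms(4)[of c "L.cls f"] by (simp add: L.quotient_smult)
  next
    case (monomial w)
    then show ?case by (rule word)
  qed
  then show ?thesis using a by (auto elim: L.quotient_cases)
qed

text \<open>By (V) or (E), the last letter of the word absorbs a vertex on its right. This is the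
  source of all local units below.\<close>

lemma word_target:
  assumes "w \<in> words (generators G)"
  obtains v where "v \<in> verts G" "word w \<otimes>\<^bsub>L.Q\<^esub> word [Vertex v] = word w"
proof -
  obtain u g where w: "w = u @ [g]" "set u \<subseteq> generators G" "g \<in> generators G"
    using assms by (cases w rule: rev_cases) (auto simp: words_def)
  obtain v where v: "v \<in> verts G" "word [g, Vertex v] = word [g]"
  proof (cases g)
    case (Vertex v)
    then show ?thesis using that[of v] w(3) word_vertex_vertex[of v v] by (auto simp: generators_def)
  next
    case (Arrow e)
    then show ?thesis using that[of "head G e"] w(3) word_arrow_ghost by (auto simp: generators_def)
  next
    case (Ghost e)
    then show ?thesis using that[of "tail G e"] w(3) word_arrow_ghost by (auto simp: generators_def)
  qed
  have "word (u @ [g, Vertex v]) = word w"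
  \<comment> \<open>The empty prefix is treated apart because the free algebra has no empty word to
    multiply by.\<close>
  proof (cases u)
    case Nil
    then show ?thesis using v w by simp
  next
    case (Cons h u')
    then have u: "u \<in> words (generators G)" using w(2) by simp
    then show ?thesis using v w word_mult[OF u, of "[g, Vertex v]"] word_mult[OF u, of "[g]"] by simp
  qed
  then have "word w \<otimes>\<^bsub>L.Q\<^esub> word [Vertex v] = word w"
    using word_mult[OF assms, of "[Vertex v]"] v(1) w(1) by simp
  then show ?thesis using that v(1) by blast
qed

text \<open>Vertices are orthogonal idempotents, so a word is killed on the right by every vertex
  other than the one it absorbs; linear combinations inherit finiteness.\<close>

lemma finite_target_support:
  assumes "a \<in> carrier L.Q"
  shows "finite {v \<in> verts G. a \<otimes>\<^bsub>L.Q\<^esub> word [Vertex v] \<noteq> \<zero>\<^bsub>L.Q\<^esub>}"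
  using assms
proof (induct a rule: L_induct)
  case zero
  then show ?case by (simp add: L_zero_mult word_closed cong: conj_cong)
next
  case (add a b)
  have "{v \<in> verts G. (a \<oplus>\<^bsub>L.Q\<^esub> b) \<otimes>\<^bsub>L.Q\<^esub> word [Vertex v] \<noteq> \<zero>\<^bsub>L.Q\<^esub>}
      \<subseteq> {v \<in> verts G. a \<otimes>\<^bsub>L.Q\<^esub> word [Vertex v] \<noteq> \<zero>\<^bsub>L.Q\<^esub>} \<union>
        {v \<in> verts G. b \<otimes>\<^bsub>L.Q\<^esub> word [Vertex v] \<noteq> \<zero>\<^bsub>L.Q\<^esub>}"
    using add(1,2) by (auto simp: LA.mult_l_distr word_closed)
  then show ?case by (rule finite_subset) (use add in simp)
next
  case (smult c a)
  have "{v \<in> verts G. (c \<odot>\<^bsub>L.Q\<^esub> a) \<otimes>\<^bsub>L.Q\<^esub> word [Vertex v] \<noteq> \<zero>\<^bsub>L.Q\<^esub>}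
      \<subseteq> {v \<in> verts G. a \<otimes>\<^bsub>L.Q\<^esub> word [Vertex v] \<noteq> \<zero>\<^bsub>L.Q\<^esub>}"
    using smult(1,2) by (auto simp: LA.mult_smult_left word_closed)
  then show ?case by (rule finite_subset) (use smult in simp)
next
  case (word w)
  then obtain v where v: "v \<in> verts G" "word w \<otimes>\<^bsub>L.Q\<^esub> word [Vertex v] = word w"
    by (rule word_target)
  have "word w \<otimes>\<^bsub>L.Q\<^esub> word [Vertex v'] = \<zero>\<^bsub>L.Q\<^esub>" if "v' \<in> verts G" "v' \<noteq> v" for v'
  proof -
    have "word w \<otimes>\<^bsub>L.Q\<^esub> word [Vertex v'] = word w \<otimes>\<^bsub>L.Q\<^esub> (word [Vertex v] \<otimes>\<^bsub>L.Q\<^esub> word [Vertex v'])"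
      using v that word by (simp add: LA.mult_assoc[symmetric] word_closed)
    also have "\<dots> = \<zero>\<^bsub>L.Q\<^esub>"
      using v that word by (simp add: word_mult word_vertex_vertex L_zero_mult word_closed)
    finally show ?thesis .
  qed
  then have "{v' \<in> verts G. word w \<otimes>\<^bsub>L.Q\<^esub> word [Vertex v'] \<noteq> \<zero>\<^bsub>L.Q\<^esub>} \<subseteq> {v}" by blast
  then show ?case by (rule finite_subset) simp
qed

end

section \<open>Unital modules and the vertices that act nontrivially\<close>

locale leavitt_module = leavitt F G + unital_right_module F "leavitt_path_algebra F G" M act
  for F :: "('k, 'r) ring_scheme" and G :: "('v, 'e) pre_digraph"
    and M :: "('k, 'm, 't) module_scheme" and act
begin

definition op where "op g x = act x (word [g])"

lemmas act_laws = act_closed[unfolded leavitt_path_algebra_eq]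
  act_add_left[unfolded leavitt_path_algebra_eq] act_add_right[unfolded leavitt_path_algebra_eq]
  act_smult_left[unfolded leavitt_path_algebra_eq] act_smult_right[unfolded leavitt_path_algebra_eq]
  act_mult[unfolded leavitt_path_algebra_eq]

lemma act_zero_right: "x \<in> carrier M \<Longrightarrow> act x \<zero>\<^bsub>L.Q\<^esub> = \<zero>\<^bsub>M\<^esub>"
  using act_laws(5)[of "\<zero>\<^bsub>F\<^esub>" x "\<zero>\<^bsub>L.Q\<^esub>"] act_laws(1)[of x "\<zero>\<^bsub>L.Q\<^esub>"] by simp

lemma act_zero_left: "a \<in> carrier L.Q \<Longrightarrow> act \<zero>\<^bsub>M\<^esub> a = \<zero>\<^bsub>M\<^esub>"
  using act_laws(4)[of "\<zero>\<^bsub>F\<^esub>" "\<zero>\<^bsub>M\<^esub>" a] act_laws(1)[of "\<zero>\<^bsub>M\<^esub>" a] by simp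

lemma op_closed [simp]: "g \<in> generators G \<Longrightarrow> x \<in> carrier M \<Longrightarrow> op g x \<in> carrier M"
  by (simp add: op_def act_laws word_closed)

lemma op_zero [simp]: "g \<in> generators G \<Longrightarrow> op g \<zero>\<^bsub>M\<^esub> = \<zero>\<^bsub>M\<^esub>"
  by (simp add: op_def act_zero_left word_closed)

lemma op_add: "g \<in> generators G \<Longrightarrow> x \<in> carrier M \<Longrightarrow> y \<in> carrier M \<Longrightarrow>
    op g (x \<oplus>\<^bsub>M\<^esub> y) = op g x \<oplus>\<^bsub>M\<^esub> op g y"
  by (simp add: op_def act_laws word_closed)

lemma op_smult: "g \<in> generators G \<Longrightarrow> c \<in> carrier F \<Longrightarrow> x \<in> carrier M \<Longrightarrow>
    op g (c \<odot>\<^bsub>M\<^esub> x) = c \<odot>\<^bsub>M\<^esub> op g x"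
  by (simp add: op_def act_laws word_closed)

lemma op_op: "g \<in> generators G \<Longrightarrow> h \<in> generators G \<Longrightarrow> x \<in> carrier M \<Longrightarrow>
    op h (op g x) = act x (word [g, h])"
  using act_laws(6)[of x "word [g]" "word [h]"] by (simp add: op_def word_closed word_mult)

lemma op_vertex: "v \<in> verts G \<Longrightarrow> w \<in> verts G \<Longrightarrow> x \<in> carrier M \<Longrightarrow>
    op (Vertex w) (op (Vertex v) x) = (if v = w then op (Vertex v) x else \<zero>\<^bsub>M\<^esub>)"
  by (simp add: op_op word_vertex_vertex act_zero_right) (simp add: op_def)

lemma op_arrow_ghost:
  assumes "e \<in> arcs G" "x \<in> carrier M"
  shows "op (Arrow e) (op (Vertex (tail G e)) x) = op (Arrow e) x"
    and "op (Vertex (head G e)) (op (Arrow e) x) = op (Arrow e) x"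
    and "op (Ghost e) (op (Vertex (head G e)) x) = op (Ghost e) x"
    and "op (Vertex (tail G e)) (op (Ghost e) x) = op (Ghost e) x"
  using assms wellformed by (simp_all add: op_op word_arrow_ghost) (simp_all add: op_def)

lemma op_ghost_arrow: "e \<in> arcs G \<Longrightarrow> f \<in> arcs G \<Longrightarrow> x \<in> carrier M \<Longrightarrow>
    op (Arrow f) (op (Ghost e) x) = (if e = f then op (Vertex (head G e)) x else \<zero>\<^bsub>M\<^esub>)"
  by (simp add: op_op word_ghost_arrow act_zero_right) (simp add: op_def)

lemma op_CK2:
  assumes v: "v \<in> verts G" "out_arcs G v \<noteq> {}" and x: "x \<in> carrier M"
  shows "op (Vertex v) x = (\<Oplus>\<^bsub>M\<^esub>e\<in>out_arcs G v. op (Ghost e) (op (Arrow e) x))"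
proof -
  have closed: "(\<lambda>e. monomial F [Arrow e, Ghost e]) \<in> out_arcs G v \<rightarrow> carrier FA"
    by (auto intro!: monomial_closed)
  have "op (Vertex v) x = act x (L.cls (\<Oplus>\<^bsub>FA\<^esub>e\<in>out_arcs G v. monomial F [Arrow e, Ghost e]))"
    using cls_rel[OF leavitt_rel.CK2[OF v, of F]] by (simp add: op_def)
  also have "\<dots> = (\<Oplus>\<^bsub>M\<^esub>e\<in>out_arcs G v. act x (L.cls (monomial F [Arrow e, Ghost e])))"
    by (rule additive_finsum[OF FA.M.abelian_group_axioms M.abelian_group_axioms,
          where h = "\<lambda>f. act x (L.cls f)", OF _ _ closed])
      (use x in \<open>auto simp: act_laws L.quotient_add[symmetric]\<close>)
  also have "\<dots> = (\<Oplus>\<^bsub>M\<^esub>e\<in>out_arcs G v. op (Ghost e) (op (Arrow e) x))"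
    using x by (intro M.add.finprod_cong') (auto simp: op_op word_closed act_laws)
  finally show ?thesis .
qed

definition support where
  "support = {v \<in> verts G. \<exists>x\<in>carrier M. op (Vertex v) x \<noteq> \<zero>\<^bsub>M\<^esub>}"

text \<open>If all vertices act as zero, so does every word, since it absorbs a vertex, and hence
  the whole algebra; unitality then leaves only the zero module.\<close>

lemma support_nonempty:
  assumes "carrier M \<noteq> {\<zero>\<^bsub>M\<^esub>}"
  shows "support \<noteq> {}"
proof
  assume empty: "support = {}"
  have act0: "act x a = \<zero>\<^bsub>M\<^esub>" if "a \<in> carrier L.Q" "x \<in> carrier M" for a x
    using that
  proof (induct a rule: L_induct)
    case (word w)
    obtain v where v: "v \<in> verts G" "word w \<otimes>\<^bsub>L.Q\<^esub> word [Vertex v] = word w"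
      by (rule word_target[OF word(1)])
    have "act x (word w \<otimes>\<^bsub>L.Q\<^esub> word [Vertex v]) = op (Vertex v) (act x (word w))"
      unfolding op_def using v(1) word by (intro act_laws(6)) (auto simp: word_closed)
    then have "act x (word w) = op (Vertex v) (act x (word w))" by (simp only: v(2))
    then show ?case
      using empty v word act_laws(1)[of x "word w"] by (auto simp: support_def word_closed)
  qed (simp_all add: act_zero_right act_laws)
  have "x = \<zero>\<^bsub>M\<^esub>" if "x \<in> carrier M" for x
  proof -
    obtain n m a where "\<forall>i<n::nat. m i \<in> carrier M \<and> a i \<in> carrier L.Q"
        "x = (\<Oplus>\<^bsub>M\<^esub>i\<in>{..<n}. act (m i) (a i))"
      using unital[OF \<open>x \<in> carrier M\<close>] unfolding leavitt_path_algebra_eq by blast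
    then show ?thesis using act0 by (auto intro!: M.add.finprod_one_eqI)
  qed
  then show False using assms M.zero_closed by blast
qed

text \<open>Unitality writes \<open>x\<close> as a finite sum of terms
  \<open>act (m i) (a i)\<close>, and each \<open>a i\<close> is killed on the right by almost all
  vertices.\<close>

lemma finite_vertex_support:
  assumes x: "x \<in> carrier M"
  shows "finite {v \<in> verts G. op (Vertex v) x \<noteq> \<zero>\<^bsub>M\<^esub>}"
proof -
  obtain n m a where nma: "\<forall>i<n::nat. m i \<in> carrier M \<and> a i \<in> carrier L.Q"
      and eq: "x = (\<Oplus>\<^bsub>M\<^esub>i\<in>{..<n}. act (m i) (a i))"
    using unital[OF x] unfolding leavitt_path_algebra_eq by blast
  have "op (Vertex v) x = \<zero>\<^bsub>M\<^esub>"
    if v: "v \<in> verts G" and a0: "\<And>i. i < n \<Longrightarrow> a i \<otimes>\<^bsub>L.Q\<^esub> word [Vertex v] = \<zero>\<^bsub>L.Q\<^esub>" for v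
  proof -
    have "op (Vertex v) x = (\<Oplus>\<^bsub>M\<^esub>i\<in>{..<n}. op (Vertex v) (act (m i) (a i)))"
      unfolding eq
      by (rule additive_finsum[OF M.abelian_group_axioms M.abelian_group_axioms])
        (use v nma in \<open>auto simp: op_add act_laws\<close>)
    also have "\<dots> = \<zero>\<^bsub>M\<^esub>"
    proof (rule M.add.finprod_one_eqI)
      fix i assume "i \<in> {..<n}"
      then show "op (Vertex v) (act (m i) (a i)) = \<zero>\<^bsub>M\<^esub>"
        using act_laws(6)[of "m i" "a i" "word [Vertex v]"] a0 nma v
        by (simp add: op_def word_closed act_zero_right)
    qed
    finally show ?thesis .
  qed
  then have "{v \<in> verts G. op (Vertex v) x \<noteq> \<zero>\<^bsub>M\<^esub>}
      \<subseteq> (\<Union>i<n. {v \<in> verts G. a i \<otimes>\<^bsub>L.Q\<^esub> word [Vertex v] \<noteq> \<zero>\<^bsub>L.Q\<^esub>})"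
    by blast
  then show ?thesis by (rule finite_subset) (use nma in \<open>auto intro: finite_target_support\<close>)
qed

text \<open>A vertex that kills a finite spanning set kills \<open>M\<close>, so the support is
  covered by the finitely many vertices not killing some spanning vector.\<close>

lemma finite_support:
  assumes "fin_dim"
  shows "finite support"
proof -
  obtain B where B: "finite B" "B \<subseteq> carrier M" "span B = carrier M"
    using assms unfolding fin_dim_def by blast
  have "op (Vertex v) x = \<zero>\<^bsub>M\<^esub>"
    if v: "v \<in> verts G" and B0: "\<And>b. b \<in> B \<Longrightarrow> op (Vertex v) b = \<zero>\<^bsub>M\<^esub>" and x: "x \<in> carrier M" for v x
  proof -
    have "submodule F {x \<in> carrier M. op (Vertex v) x = \<zero>\<^bsub>M\<^esub>} M"
      using v by (auto intro!: submodule.intro module_axioms simp: op_add op_smult)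
    then have "span B \<subseteq> {x \<in> carrier M. op (Vertex v) x = \<zero>\<^bsub>M\<^esub>}"
      by (rule span_is_subset[rotated]) (use B B0 in auto)
    then show ?thesis using B x by blast
  qed
  then have "support \<subseteq> (\<Union>b\<in>B. {v \<in> verts G. op (Vertex v) b \<noteq> \<zero>\<^bsub>M\<^esub>})"
    unfolding support_def by blast
  then show ?thesis
    by (rule finite_subset) (use B finite_vertex_support in auto)
qed

text \<open>By (CK1), the ghost of \<open>e\<close> followed by \<open>e\<close> acts as
  \<open>head G e\<close>. Where the result is nonzero, so is the intermediate vector, and that one
  is fixed by \<open>tail G e\<close>.\<close>

lemma support_pred:
  assumes e: "e \<in> arcs G" and h: "head G e \<in> support"
  shows "tail G e \<in> support"
proof -
  obtain x where x: "x \<in> carrier M" "op (Vertex (head G e)) x \<noteq> \<zero>\<^bsub>M\<^esub>"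
    using h unfolding support_def by blast
  then have "op (Arrow e) (op (Ghost e) x) \<noteq> \<zero>\<^bsub>M\<^esub>" using e by (simp add: op_ghost_arrow)
  then have "op (Ghost e) x \<noteq> \<zero>\<^bsub>M\<^esub>" using e by auto
  then have "op (Vertex (tail G e)) (op (Ghost e) x) \<noteq> \<zero>\<^bsub>M\<^esub>" using e x by (simp add: op_arrow_ghost)
  then show ?thesis using e x wellformed unfolding support_def by auto
qed

text \<open>(CK2) factors the action of \<open>v\<close> through the spaces at the heads of its
  outgoing arrows; if these all vanish, so does the one at \<open>v\<close>.\<close>

lemma support_succ:
  assumes v: "v \<in> support" "out_arcs G v \<noteq> {}"
  shows "\<exists>e\<in>out_arcs G v. head G e \<in> support"
proof (rule ccontr)
  assume neg: "\<not> (\<exists>e\<in>out_arcs G v. head G e \<in> support)"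
  obtain x where x: "x \<in> carrier M" "op (Vertex v) x \<noteq> \<zero>\<^bsub>M\<^esub>" "v \<in> verts G"
    using v unfolding support_def by blast
  have "op (Ghost e) (op (Arrow e) x) = \<zero>\<^bsub>M\<^esub>" if e: "e \<in> out_arcs G v" for e
  proof -
    have "op (Vertex (head G e)) (op (Arrow e) x) = \<zero>\<^bsub>M\<^esub>"
      using neg e x wellformed unfolding support_def by auto
    then show ?thesis using e x by (simp add: op_arrow_ghost)
  qed
  then have "op (Vertex v) x = \<zero>\<^bsub>M\<^esub>"
    unfolding op_CK2[OF x(3) v(2) x(1)] by (rule M.add.finprod_one_eqI)
  then show False using x by simp
qed

text \<open>The ghost of a path is the product of the ghosts in reverse order, so on a right module
  the ghost of the last arrow acts first: hence \<open>foldr\<close> here, but \<open>foldl\<close>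
  in \<open>arrow_walk\<close>.\<close>

definition ghost_walk where "ghost_walk c x = foldr (\<lambda>e. op (Ghost e)) c x"

definition arrow_walk where "arrow_walk c x = foldl (\<lambda>x e. op (Arrow e) x) x c"

lemma ghost_walk_linear:
  assumes "set c \<subseteq> arcs G"
  shows "x \<in> carrier M \<Longrightarrow> ghost_walk c x \<in> carrier M"
    and "x \<in> carrier M \<Longrightarrow> y \<in> carrier M \<Longrightarrow>
      ghost_walk c (x \<oplus>\<^bsub>M\<^esub> y) = ghost_walk c x \<oplus>\<^bsub>M\<^esub> ghost_walk c y"
    and "k \<in> carrier F \<Longrightarrow> x \<in> carrier M \<Longrightarrow> ghost_walk c (k \<odot>\<^bsub>M\<^esub> x) = k \<odot>\<^bsub>M\<^esub> ghost_walk c x"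
proof -
  have closed: "x \<in> carrier M \<Longrightarrow> ghost_walk c x \<in> carrier M" if "set c \<subseteq> arcs G" for c x
    using that by (induct c) (auto simp: ghost_walk_def)
  then show "x \<in> carrier M \<Longrightarrow> ghost_walk c x \<in> carrier M" using assms .
  show "x \<in> carrier M \<Longrightarrow> y \<in> carrier M \<Longrightarrow>
      ghost_walk c (x \<oplus>\<^bsub>M\<^esub> y) = ghost_walk c x \<oplus>\<^bsub>M\<^esub> ghost_walk c y"
    using assms closed by (induct c) (auto simp: ghost_walk_def op_add)
  show "k \<in> carrier F \<Longrightarrow> x \<in> carrier M \<Longrightarrow> ghost_walk c (k \<odot>\<^bsub>M\<^esub> x) = k \<odot>\<^bsub>M\<^esub> ghost_walk c x"
    using assms closed by (induct c) (auto simp: ghost_walk_def op_smult)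
qed

lemma arrow_walk_zero: "set c \<subseteq> arcs G \<Longrightarrow> arrow_walk c \<zero>\<^bsub>M\<^esub> = \<zero>\<^bsub>M\<^esub>"
  by (induct c) (auto simp: arrow_walk_def)

text \<open>Iterated (CK1): the arrows undo the ghosts one by one. In particular a ghost path acts
  injectively on the vectors fixed by its end vertex.\<close>

lemma arrow_walk_ghost_walk:
  assumes "awalk u c w" "x \<in> carrier M" "op (Vertex w) x = x"
  shows "op (Vertex u) (ghost_walk c x) = ghost_walk c x \<and> arrow_walk c (ghost_walk c x) = x"
  using assms(1)
proof (induct c arbitrary: u)
  case Nil
  then show ?case using assms by (simp add: awalk_simps ghost_walk_def arrow_walk_def)
next
  case (Cons e c)
  then have e: "e \<in> arcs G" "tail G e = u" and c: "awalk (head G e) c w" "set c \<subseteq> arcs G"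
    by (auto simp: awalk_Cons_iff awalk_def)
  have y: "ghost_walk c x \<in> carrier M" by (rule ghost_walk_linear(1)[OF c(2) assms(2)])
  show ?case
    using Cons.hyps[OF c(1)] e y op_arrow_ghost(4)[OF e(1) y] op_ghost_arrow[OF e(1) e(1) y]
    by (simp add: ghost_walk_def arrow_walk_def)
qed

lemma support_no_exit:
  assumes fd: "fin_dim" and walk: "awalk v (e # c) v" and f: "f \<in> arcs G" "tail G f = v" "f \<noteq> e"
  shows "head G f \<notin> support"
proof
  assume "head G f \<in> support"
  then obtain z where z: "z \<in> carrier M" "op (Vertex (head G f)) z \<noteq> \<zero>\<^bsub>M\<^esub>"
    unfolding support_def by blast
  have arcs: "set (e # c) \<subseteq> arcs G" "v \<in> verts G" using walk by (auto simp: awalk_def)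
  let ?p = "op (Vertex v)" and ?q = "ghost_walk (e # c)"
  have pc [simp]: "?p x \<in> carrier M" and qc [simp]: "?q x \<in> carrier M" if "x \<in> carrier M" for x
    using that arcs ghost_walk_linear(1)[OF arcs(1)] by auto
  have pp: "?p (?p x) = ?p x" and pq: "?p (?q (?p x)) = ?q (?p x)"
    and aq: "arrow_walk (e # c) (?q (?p x)) = ?p x" if "x \<in> carrier M" for x
    using that arrow_walk_ghost_walk[OF walk, of "?p x"] op_vertex[of v v x] arcs(2) by auto
  \<comment> \<open>\<open>T\<close> acts as \<open>c\<close>-star on \<open>M v\<close> and as the identity on a complement, which avoids
    working with \<open>M v\<close> as a vector space of its own.\<close>
  define T where "T x = (x \<ominus>\<^bsub>M\<^esub> ?p x) \<oplus>\<^bsub>M\<^esub> ?q (?p x)" for x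
  \<comment> \<open>The projection \<open>?p\<close> discards the summand in the complement. So
    \<open>T x = 0\<close> gives \<open>?q (?p x) = 0\<close>, then \<open>?p x = 0\<close> by
    \<open>aq\<close>, and finally \<open>x = 0\<close>.\<close>
  have pT: "?p (T x) = ?q (?p x)" if x: "x \<in> carrier M" for x
  proof -
    have "?p (x \<ominus>\<^bsub>M\<^esub> ?p x) = ?p x \<ominus>\<^bsub>M\<^esub> ?p x"
      using x arcs(2) by (simp add: a_minus_def op_add op_smult pp flip: smult_minus_1)
    then show ?thesis using x arcs(2) by (simp add: T_def op_add pq)
  qed
  have lin: "linear_map F M M T"
  proof (intro linear_map.intro vectorspace_axioms mod_hom.intro module_axioms mod_hom_axioms.intro)
    show "T \<in> module_hom F M M"
      unfolding module_hom_def T_def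
      using arcs(2) by (auto simp: op_add op_smult ghost_walk_linear[OF arcs(1)] smult_r_distr a_minus_def
          M.a_ac M.minus_add smult_r_minus)
  qed
  interpret T: linear_map F M M T by (rule lin)
  have "x = \<zero>\<^bsub>M\<^esub>" if x: "x \<in> carrier M" and T0: "T x = \<zero>\<^bsub>M\<^esub>" for x
  proof -
    have "?q (?p x) = \<zero>\<^bsub>M\<^esub>" using pT[OF x] T0 arcs(2) by simp
    moreover from this have "?p x = \<zero>\<^bsub>M\<^esub>" using aq[OF x] arrow_walk_zero[OF arcs(1)] by simp
    ultimately show ?thesis using x T0 by (simp add: T_def)
  qed
  then have "inj_on T (carrier M)"
    by (intro T.Ke0_imp_inj) (auto simp: T.ker_def)
  then have surj: "T ` carrier M = carrier M" by (rule linear_inj_imp_surj[OF lin fd])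
  \<comment> \<open>The ghost of \<open>f\<close> followed by \<open>f\<close> is now computed on
    \<open>z\<close> in two ways. By (CK1) it gives \<open>z\<close> times \<open>head G f\<close>,
    which is nonzero. By surjectivity the intermediate vector is also a value of \<open>?q\<close>,
    whose last operator is the ghost of \<open>e\<close>, and \<open>f\<close> kills such values by
    (CK1).\<close>
  have y: "op (Ghost f) z \<in> carrier M" using f z by simp
  then obtain x where x: "x \<in> carrier M" "op (Ghost f) z = T x" using surj by blast
  have "op (Ghost f) z = ?p (op (Ghost f) z)" using op_arrow_ghost(4)[OF f(1) z(1)] f(2) by simp
  also have "\<dots> = ?q (?p x)" using pT x by simp
  also have "\<dots> = op (Ghost e) (ghost_walk c (?p x))" by (simp add: ghost_walk_def)
  finally have "op (Arrow f) (op (Ghost f) z) = op (Arrow f) (op (Ghost e) (ghost_walk c (?p x)))"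
    by simp
  moreover have "ghost_walk c (?p x) \<in> carrier M"
    using arcs x ghost_walk_linear(1)[of c] by simp
  ultimately show False using z f arcs by (simp add: op_ghost_arrow)
qed

end

section \<open>Cycles and maximality\<close>

lemma range_rotate_rotate: "range (\<lambda>n. rotate n (rotate k p)) = range (\<lambda>n. rotate n p)"
proof
  show "range (\<lambda>n. rotate n (rotate k p)) \<subseteq> range (\<lambda>n. rotate n p)"
    by (auto simp: rotate_rotate)
  show "range (\<lambda>n. rotate n p) \<subseteq> range (\<lambda>n. rotate n (rotate k p))"
  proof (cases "p = []")
    case False
    \<comment> \<open>Full turns are invisible; adding \<open>k\<close> of them before subtracting
      \<open>k\<close> keeps the index a natural number.\<close>
    have "rotate m p = rotate (m + k * length p - k) (rotate k p)" for m
    proof -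
      have "k \<le> k * length p" using False by (cases p) simp_all
      then have "m + k * length p - k + k = m + k * length p"
        by (intro le_add_diff_inverse2 trans_le_add2)
      moreover have "rotate (m + k * length p) p = rotate m p"
        by (metis mod_mult_self1 rotate_conv_mod)
      ultimately show ?thesis by (simp add: rotate_rotate)
    qed
    then show ?thesis by blast
  qed auto
qed

context wf_digraph
begin

text \<open>\<open>cycle\<close> demands distinct vertices after the first one. On a closed walk the
  first and last vertices agree, so dropping either gives the same condition; the form with sources
  is the one used below.\<close>

lemma cycle_iff_distinct_tails:
  "cycle p \<longleftrightarrow> p \<noteq> [] \<and> (\<exists>v. awalk v p v) \<and> distinct (map (tail G) p)"
proof (cases p)
  case (Cons e c)
  have "distinct (tl (awalk_verts v p)) \<longleftrightarrow> distinct (map (tail G) p)" if "awalk v p v" for v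
  proof -
    have "awalk_verts v p = map (tail G) p @ [v]"
      using that Cons by (auto simp: awalk_verts_conv awalk_conv)
    moreover have "tail G e = v" using that Cons by (simp add: awalk_Cons_iff)
    ultimately show ?thesis using Cons by auto
  qed
  then show ?thesis unfolding cycle_def by blast
qed (simp add: cycle_def)

lemma cycle_arcs: "cycle p \<Longrightarrow> set p \<subseteq> arcs G"
  unfolding cycle_def by (auto simp: awalk_def)

lemma cycle_rotate: "cycle p \<Longrightarrow> cycle (rotate n p)"
proof (induct n)
  case (Suc n)
  then have "cycle (rotate n p)" by simp
  then obtain e c v where ec: "rotate n p = e # c" "awalk v (e # c) v" "distinct (map (tail G) (e # c))"
    by (metis cycle_iff_distinct_tails neq_Nil_conv)
  then have "awalk (head G e) c v" "awalk v [e] (head G e)"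
    using arc_implies_awalk[of e] by (auto simp only: awalk_Cons_iff)
  then have "awalk (head G e) (c @ [e]) (head G e)" by (rule awalk_appendI)
  then show ?case using ec unfolding cycle_iff_distinct_tails by auto
qed simp

lemma cycle_from:
  assumes "cycle p" "v \<in> tail G ` set p"
  obtains e c n where "rotate n p = e # c" "tail G e = v" "cycle (e # c)"
    "awalk (head G e) c v" "v \<notin> tail G ` set c" "set (e # c) = set p"
proof -
  obtain n where n: "n < length p" "tail G (p ! n) = v"
    using assms(2) by (auto simp: in_set_conv_nth)
  then have "p \<noteq> []" by auto
  then obtain e c where ec: "rotate n p = e # c" by (metis neq_Nil_conv rotate_is_Nil_conv)
  have "tail G e = v" using hd_rotate_conv_nth[OF \<open>p \<noteq> []\<close>, of n] n ec by simp
  moreover have "cycle (e # c)" using cycle_rotate[OF assms(1), of n] ec by simp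
  moreover have "set (e # c) = set p" using ec by (metis set_rotate)
  ultimately show ?thesis
    using that[OF ec] unfolding cycle_iff_distinct_tails by (auto simp: awalk_Cons_iff)
qed

lemma vertices_of_cycle: "vertices_of G (Cycle (range (\<lambda>n. rotate n p))) = tail G ` set p"
  by simp

lemma leads_to_refl: "v \<in> verts G \<Longrightarrow> leads_to G v v"
  unfolding leads_to_def by (auto simp: awalk_Nil_iff intro!: exI[of _ "[]"])

lemma leads_to_trans: "leads_to G u v \<Longrightarrow> leads_to G v w \<Longrightarrow> leads_to G u w"
  unfolding leads_to_def by (meson awalk_appendI)

lemma awalk_tail_leads_to:
  assumes "awalk u p w" "e \<in> set p"
  shows "leads_to G (tail G e) w"
proof -
  obtain p1 p2 where "p = p1 @ e # p2" using split_list[OF assms(2)] by blast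
  then have "awalk (tail G e) (e # p2) w" using assms(1) by (auto simp: awalk_Cons_iff)
  then show ?thesis unfolding leads_to_def by blast
qed

lemma cycle_leads_to:
  assumes "cycle p" "v \<in> tail G ` set p" "w \<in> tail G ` set p"
  shows "leads_to G v w"
proof -
  obtain e c n where "awalk (head G e) c w" "tail G e = w" "cycle (e # c)" "set (e # c) = set p"
    using cycle_from[OF assms(1,3)] by metis
  moreover from this have "awalk w (e # c) w"
    unfolding cycle_iff_distinct_tails by (auto simp: awalk_Cons_iff)
  ultimately show ?thesis using assms(2) awalk_tail_leads_to by fastforce
qed

lemma cycle_head_in_tails:
  assumes "cycle p" "e \<in> set p"
  shows "head G e \<in> tail G ` set p"
proof -
  obtain f c n where fc: "tail G f = tail G e" "cycle (f # c)" "awalk (head G f) c (tail G e)" "set (f # c) = set p"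
    using cycle_from[OF assms(1) imageI[OF assms(2)]] by metis
  then have "f = e" using assms(2)
    unfolding cycle_iff_distinct_tails by (metis distinct_map inj_onD list.set_intros(1))
  then show ?thesis
    using fc by (cases c) (auto simp: awalk_simps)
qed

text \<open>Cut the walk at a repeated source. The alternative of a closed walk serves the
  induction: the piece cut out is closed but may have no repeated source left.\<close>

lemma exists_cycle_in_awalk:
  assumes "awalk u p w" "\<not> distinct (map (tail G) p) \<or> (p \<noteq> [] \<and> u = w)"
  shows "\<exists>c. cycle c \<and> set c \<subseteq> set p"
  using assms
proof (induct "length p" arbitrary: p u w rule: less_induct)
  case less
  show ?case
  proof (cases "distinct (map (tail G) p)")
    case True
    then have "cycle p" using less.prems unfolding cycle_iff_distinct_tails by blast
    then show ?thesis by blast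
  next
    case False
    then obtain e p' where p: "p = e # p'" by (cases p) auto
    show ?thesis
    proof (cases "distinct (map (tail G) p')")
      case False
      have "awalk (head G e) p' w" using less.prems p by (simp add: awalk_Cons_iff)
      then show ?thesis using less.hyps[of p'] False p by fastforce
    next
      case True
      then obtain f where f: "f \<in> set p'" "tail G f = tail G e"
        using \<open>\<not> distinct (map (tail G) p)\<close> p by auto
      then obtain p1 p2 where p': "p' = p1 @ f # p2" by (metis split_list)
      then have "awalk u ((e # p1) @ f # p2) w" using less.prems p by simp
      then have "awalk u (e # p1) (tail G f)" "u = tail G e"
        by (auto simp: awalk_Cons_iff simp del: append_Cons)
      then show ?thesis using less.hyps[of "e # p1" u u] f(2) p p' by auto
    qed
  qed
qed

text \<open>Both walks take the same arrow at a common vertex, and neither can stop before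
  \<open>b\<close> or continue past it.\<close>

lemma awalk_unique:
  assumes "awalk u p b" "b \<notin> tail G ` set p" "awalk u q b" "b \<notin> tail G ` set q"
    and "\<And>e f. e \<in> set p \<Longrightarrow> f \<in> set q \<Longrightarrow> tail G e = tail G f \<Longrightarrow> e = f"
  shows "p = q"
  using assms
proof (induct p arbitrary: u q)
  case Nil
  then show ?case by (cases q) (auto simp: awalk_simps)
next
  case (Cons e p)
  then obtain f q' where q: "q = f # q'" by (cases q) (auto simp: awalk_simps)
  then have "e = f" using Cons.prems by (auto simp: awalk_Cons_iff)
  then show ?case using Cons.hyps[of "head G e" q'] Cons.prems q by (auto simp: awalk_Cons_iff)
qed

text \<open>The hypotheses on \<open>S\<close> collect what a finite dimensional module provides
  through its \<open>support\<close>; the rest is graph theory.\<close>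

lemma exists_maximal_sink_or_cycle:
  assumes S: "finite S" "S \<noteq> {}" "S \<subseteq> verts G"
    and pred: "\<And>e. e \<in> arcs G \<Longrightarrow> head G e \<in> S \<Longrightarrow> tail G e \<in> S"
    and succ: "\<And>v. v \<in> S \<Longrightarrow> out_arcs G v \<noteq> {} \<Longrightarrow> \<exists>e\<in>out_arcs G v. head G e \<in> S"
    and no_exit: "\<And>v e c f. awalk v (e # c) v \<Longrightarrow> v \<in> S \<Longrightarrow> f \<in> arcs G \<Longrightarrow> tail G f = v \<Longrightarrow>
      f \<noteq> e \<Longrightarrow> head G f \<notin> S"
  shows "\<exists>u. maximal_sink_or_cycle G u \<and> finite (predecessors G u)"
proof -
  have closed: "v \<in> S" if vw: "leads_to G v w" "w \<in> S" for v w
  proof -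
    obtain p where "awalk v p w" using vw(1) unfolding leads_to_def by blast
    then show ?thesis using vw(2)
      by (induct p arbitrary: v) (auto simp: awalk_simps pred)
  qed
  \<comment> \<open>Rotate the cycle to start at the source of \<open>f\<close>. If its first arrow
    were not \<open>f\<close>, then \<open>f\<close> would be an exit into \<open>S\<close>.\<close>
  have exit: "f \<in> set c" if cf: "cycle c" "tail G ` set c \<subseteq> S" "f \<in> arcs G" "tail G f \<in> tail G ` set c"
      "head G f \<in> S" for c f
  proof -
    obtain e c' n where "tail G e = tail G f" "cycle (e # c')" "awalk (head G e) c' (tail G f)" "set (e # c') = set c"
      using cycle_from[OF cf(1,4)] by metis
    moreover from this have "awalk (tail G f) (e # c') (tail G f)"
      unfolding cycle_iff_distinct_tails by (auto simp: awalk_Cons_iff)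
    ultimately show ?thesis using no_exit[of "tail G f" e c' f] cf by auto
  qed
  \<comment> \<open>Every vertex of the walk leads to \<open>w\<close> and so lies in
    \<open>S\<close>; by \<open>exit\<close>, each of its arrows then belongs to the cycle.\<close>
  have stay: "w \<in> tail G ` set c" if "cycle c" "tail G ` set c \<subseteq> S" "awalk v p w"
      "v \<in> tail G ` set c" "w \<in> S" for c v p w
    using that(3,4)
  proof (induct p arbitrary: v)
    case (Cons f p)
    then have "leads_to G (head G f) w" unfolding leads_to_def by (auto simp: awalk_Cons_iff)
    then have "f \<in> set c"
      using exit[OF that(1,2), of f] closed that(5) Cons.prems by (auto simp: awalk_Cons_iff)
    then show ?case using Cons cycle_head_in_tails[OF that(1)] by (auto simp: awalk_Cons_iff)
  qed (simp add: awalk_simps)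
  \<comment> \<open>By \<open>exit\<close>, the two cycles use the same arrow at every shared
    source; rotated to start at \<open>w\<close>, they trace the same walk.\<close>
  have unique: "range (\<lambda>n. rotate n c) = range (\<lambda>n. rotate n c')"
    if cc: "cycle c" "tail G ` set c \<subseteq> S" "cycle c'" "tail G ` set c' \<subseteq> S"
      "w \<in> tail G ` set c" "w \<in> tail G ` set c'" for c c' w
  proof -
    obtain e d n where d: "rotate n c = e # d" "tail G e = w" "cycle (e # d)" "awalk (head G e) d w"
        "w \<notin> tail G ` set d" "set (e # d) = set c"
      using cycle_from[OF cc(1,5)] .
    obtain e' d' n' where d': "rotate n' c' = e' # d'" "tail G e' = w" "cycle (e' # d')"
        "awalk (head G e') d' w" "w \<notin> tail G ` set d'" "set (e' # d') = set c'"
      using cycle_from[OF cc(3,6)] .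
    have inj: "inj_on (tail G) (set c)"
      using cc(1) unfolding cycle_iff_distinct_tails by (simp add: distinct_map)
    have same: "x = y" if "x \<in> set c" "y \<in> set c'" "tail G x = tail G y" for x y
    proof -
      have "y \<in> arcs G"
        using that(2) cycle_arcs[OF \<open>cycle c'\<close>] by blast
      moreover have "head G y \<in> S"
        using cycle_head_in_tails[OF \<open>cycle c'\<close> that(2)] \<open>tail G ` set c' \<subseteq> S\<close> by auto
      ultimately have "y \<in> set c"
        using exit[OF \<open>cycle c\<close> \<open>tail G ` set c \<subseteq> S\<close>, of y] that by (metis image_eqI)
      then show ?thesis using inj that by (auto dest: inj_onD)
    qed
    have "e = e'" using same[of e e'] d d' by auto
    moreover have "d = d'"
    proof (rule awalk_unique[of "head G e" d w d'])
      show "awalk (head G e) d' w" using d'(4) \<open>e = e'\<close> by simp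
      show "x = y" if "x \<in> set d" "y \<in> set d'" "tail G x = tail G y" for x y
        using same[of x y] that d(6) d'(6) by auto
    qed (use d d' in auto)
    ultimately have "rotate n c = rotate n' c'" using d d' by simp
    then show ?thesis using range_rotate_rotate[of n c] range_rotate_rotate[of n' c'] by simp
  qed
  have no_out: False if "cycle c" "v \<in> tail G ` set c" "out_arcs G v = {}" for c v
    using that(2,3) cycle_arcs[OF that(1)] by (auto simp: out_arcs_def)
  \<comment> \<open>A sink leads only to itself. A cycle leading to a vertex \<open>w\<close> of
    \<open>u\<close> lies in \<open>S\<close> and contains \<open>w\<close> by \<open>stay\<close>;
    so \<open>u\<close> is not a sink, and \<open>unique\<close> identifies the two cycles.\<close>
  have max: "maximal_sink_or_cycle G u \<and> finite (predecessors G u)"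
    if u: "is_sink_or_cycle G u" and uS: "vertices_of G u \<subseteq> S" for u
  proof -
    have "u' = u" if u': "is_sink_or_cycle G u'" and x: "x \<in> vertices_of G u'"
        and w: "w \<in> vertices_of G u" and xw: "leads_to G x w" for u' x w
    proof (cases u')
      case (Sink v)
      then have v: "x = v" "out_arcs G v = {}" using u' x by auto
      obtain p where "awalk v p w" using xw v unfolding leads_to_def by blast
      then have "w = v" using v(2) by (cases p) (auto simp: awalk_simps out_arcs_def)
      show ?thesis
      proof (cases u)
        case Sink
        then show ?thesis using \<open>u' = _\<close> w \<open>w = v\<close> by simp
      next
        case (Cycle C)
        then obtain c where "cycle c" "C = range (\<lambda>n. rotate n c)" using u by auto
        then show ?thesis using no_out[of c v] w v(2) Cycle \<open>w = v\<close> by auto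
      qed
    next
      case (Cycle C')
      then obtain c' where c': "cycle c'" "C' = range (\<lambda>n. rotate n c')" using u' by auto
      then have x': "x \<in> tail G ` set c'" using x Cycle by auto
      have wS: "w \<in> S" using w uS by blast
      have "tail G ` set c' \<subseteq> S"
        using closed[OF leads_to_trans[OF cycle_leads_to[OF c'(1) _ x'] xw] wS] by blast
      moreover have w': "w \<in> tail G ` set c'"
        using stay[OF c'(1) calculation _ x' wS] xw unfolding leads_to_def by blast
      ultimately show ?thesis
      proof (cases u)
        case (Sink v)
        then show ?thesis using no_out[OF c'(1) w'] u w by auto
      next
        case (Cycle C)
        then obtain c where c: "cycle c" "C = range (\<lambda>n. rotate n c)" using u by auto
        then have "w \<in> tail G ` set c" "tail G ` set c \<subseteq> S"
          using w uS Cycle by auto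
        then show ?thesis
          using unique[OF c'(1) \<open>tail G ` set c' \<subseteq> S\<close> c(1) _ w'] c c' Cycle \<open>u' = _\<close> by simp
      qed
    qed
    then have "maximal_sink_or_cycle G u" unfolding maximal_sink_or_cycle_def using u by blast
    moreover have "predecessors G u \<subseteq> S" unfolding predecessors_def using closed uS by blast
    ultimately show ?thesis using S(1) finite_subset by blast
  qed
  show ?thesis
  proof (cases "\<exists>v\<in>S. out_arcs G v = {}")
    case True
    then obtain v where "v \<in> S" "out_arcs G v = {}" by blast
    then show ?thesis using max[of "Sink v"] S(3) by auto
  next
    case False
    \<comment> \<open>Without sinks in \<open>S\<close>, \<open>succ\<close> prolongs walks
      indefinitely; one with \<open>card S + 1\<close> arrows must repeat a source.\<close>
    have "\<exists>p w. awalk v p w \<and> length p = n \<and> tail G ` set p \<subseteq> S" if "v \<in> S" for v n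
      using that
    proof (induct n arbitrary: v)
      case 0
      then show ?case using S(3) by (intro exI[of _ "[]"]) (auto simp: awalk_simps)
    next
      case (Suc n)
      have "out_arcs G v \<noteq> {}" using False Suc.prems by simp
      then obtain e where e: "e \<in> out_arcs G v" "head G e \<in> S"
        using succ[OF Suc.prems] by blast
      then obtain p w where "awalk (head G e) p w" "length p = n" "tail G ` set p \<subseteq> S"
        using Suc.hyps by blast
      then show ?case using e Suc.prems
        by (intro exI[of _ "e # p"] exI[of _ w]) (auto simp: awalk_simps)
    qed
    then obtain v p w where p: "awalk v p w" "length p = Suc (card S)" "tail G ` set p \<subseteq> S"
      using S(2) by blast
    have "\<not> distinct (map (tail G) p)"
    proof
      assume "distinct (map (tail G) p)"
      then have "card (set (map (tail G) p)) = Suc (card S)"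
        using p(2) distinct_card by fastforce
      then show False using card_mono[OF S(1), of "set (map (tail G) p)"] p(3) by simp
    qed
    then obtain c where "cycle c" "set c \<subseteq> set p" using exists_cycle_in_awalk[OF p(1)] by blast
    then show ?thesis using max[of "Cycle (range (\<lambda>n. rotate n c))"] p(3) by auto
  qed
qed

end

section \<open>Modules from branching systems\<close>

lemma (in leavitt_module) graph_criterion:
  assumes "fin_dim" "carrier M \<noteq> {\<zero>\<^bsub>M\<^esub>}"
  shows "\<exists>u. maximal_sink_or_cycle G u \<and> finite (predecessors G u)"
proof (rule exists_maximal_sink_or_cycle)
  show "finite support" by (rule finite_support[OF assms(1)])
  show "support \<noteq> {}" by (rule support_nonempty[OF assms(2)])
  show "support \<subseteq> verts G" by (auto simp: support_def)
qed (use support_pred support_succ support_no_exit[OF assms(1)] in auto)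

text \<open>
  The elements of \<open>X\<close> index a basis, \<open>start p\<close> is the vertex fixing \<open>p\<close>, and \<open>glue e q\<close> is the
  result of acting on \<open>q\<close> by \<open>e\<close>-star: (CK1) amounts to injectivity of gluing, (CK2) to
  surjectivity over non-sinks.
\<close>

locale branching_system = wf_digraph G
  for G :: "('v, 'e) pre_digraph" +
  fixes X :: "'x set" and start :: "'x \<Rightarrow> 'v" and glue :: "'e \<Rightarrow> 'x \<Rightarrow> 'x"
  assumes finite_X: "finite X" and nonempty_X: "X \<noteq> {}"
    and start_in_verts: "p \<in> X \<Longrightarrow> start p \<in> verts G"
    and glue_closed: "\<lbrakk>e \<in> arcs G; q \<in> X; head G e = start q\<rbrakk> \<Longrightarrow> glue e q \<in> X"
    and start_glue: "\<lbrakk>e \<in> arcs G; q \<in> X; head G e = start q\<rbrakk> \<Longrightarrow> start (glue e q) = tail G e"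
    and glue_inj: "\<lbrakk>e \<in> arcs G; q \<in> X; head G e = start q; e' \<in> arcs G; q' \<in> X; head G e' = start q';
      glue e q = glue e' q'\<rbrakk> \<Longrightarrow> e = e' \<and> q = q'"
    and glue_surj: "\<lbrakk>p \<in> X; out_arcs G (start p) \<noteq> {}\<rbrakk> \<Longrightarrow>
      \<exists>e\<in>arcs G. \<exists>q\<in>X. head G e = start q \<and> glue e q = p"

text \<open>Moves the finite index set into \<open>nat\<close>, so that the module built from it has
  elements of type \<open>nat => 'k\<close>.\<close>

lemma (in branching_system) transfer_inj:
  assumes f: "inj_on f X"
  shows "branching_system G (f ` X) (start \<circ> inv_into X f) (\<lambda>e i. f (glue e (inv_into X f i)))"
proof
  have [simp]: "inv_into X f (f p) = p" if "p \<in> X" for p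
    using f that by simp
  show "finite (f ` X)" "f ` X \<noteq> {}" using finite_X nonempty_X by auto
  show "(start \<circ> inv_into X f) p \<in> verts G" if "p \<in> f ` X" for p
    using that start_in_verts by auto
  show "f (glue e (inv_into X f q)) \<in> f ` X"
    if "e \<in> arcs G" "q \<in> f ` X" "head G e = (start \<circ> inv_into X f) q" for e q
    using that glue_closed by auto
  show "(start \<circ> inv_into X f) (f (glue e (inv_into X f q))) = tail G e"
    if "e \<in> arcs G" "q \<in> f ` X" "head G e = (start \<circ> inv_into X f) q" for e q
    using that glue_closed start_glue by auto
  show "e = e' \<and> q = q'"
    if "e \<in> arcs G" "q \<in> f ` X" "head G e = (start \<circ> inv_into X f) q"
      "e' \<in> arcs G" "q' \<in> f ` X" "head G e' = (start \<circ> inv_into X f) q'"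
      "f (glue e (inv_into X f q)) = f (glue e' (inv_into X f q'))" for e q e' q'
  proof -
    note eq = that
    obtain r r' where r: "r \<in> X" "q = f r" "r' \<in> X" "q' = f r'" using eq(2,5) by blast
    then have "glue e r = glue e' r'"
      using \<open>inj_on f X\<close> eq glue_closed by (auto dest: inj_onD)
    then show ?thesis using glue_inj[of e r e' r'] eq r by auto
  qed
  show "\<exists>e\<in>arcs G. \<exists>q\<in>f ` X. head G e = (start \<circ> inv_into X f) q \<and> f (glue e (inv_into X f q)) = p"
    if "p \<in> f ` X" "out_arcs G ((start \<circ> inv_into X f) p) \<noteq> {}" for p
  proof -
    note p = that
    obtain r where r: "r \<in> X" "p = f r" using p(1) by blast
    then obtain e q where "e \<in> arcs G" "q \<in> X" "head G e = start q" "glue e q = r"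
      using glue_surj[of r] p(2) by auto
    then show ?thesis using r by (intro bexI[of _ e] bexI[of _ "f q"]) auto
  qed
qed

lemma (in wf_digraph) exists_branching_system:
  assumes rf: "row_finite G" and max: "maximal_sink_or_cycle G u" and fin: "finite (predecessors G u)"
  shows "\<exists>(X :: nat set) start glue. branching_system G X start glue"
proof -
  have u: "is_sink_or_cycle G u" using max unfolding maximal_sink_or_cycle_def by blast
  obtain b where b: "b \<in> vertices_of G u" "b \<in> verts G"
  proof (cases u)
    case (Sink v)
    then show ?thesis using that u by auto
  next
    case (Cycle C)
    then obtain p where p: "cycle p" "C = range (\<lambda>n. rotate n p)" using u by auto
    then have "hd p \<in> set p" "hd p \<in> arcs G"
      using cycle_arcs[OF p(1)] unfolding cycle_def by (auto simp: subset_iff)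
    then show ?thesis using that[of "tail G (hd p)"] p Cycle by auto
  qed
  \<comment> \<open>The maximality condition is exploited through this fact.\<close>
  have only_cycle: "u = Cycle (range (\<lambda>n. rotate n c)) \<and> b \<in> tail G ` set c"
    if c: "cycle c" "v \<in> tail G ` set c" "leads_to G v b" for c v
  proof -
    have "Cycle (range (\<lambda>n. rotate n c)) = u"
      using max b(1) c unfolding maximal_sink_or_cycle_def by (metis is_sink_or_cycle.simps(2) vertices_of_cycle)
    then show ?thesis using b(1) by auto
  qed
  define X where "X = {q. (\<exists>v. awalk v q b) \<and> b \<notin> tail G ` set q}"
  define start where "start q = (if q = [] then b else tail G (hd q))" for q
  \<comment> \<open>An arrow leaving \<open>b\<close> would make the path meet \<open>b\<close> too
    early; it completes the cycle instead, and the path is reset to the empty one.\<close>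
  define glue where "glue e q = (if tail G e = b then [] else e # q)" for e q
  have walk: "awalk (start q) q b" if "q \<in> X" for q
    using that b(2) unfolding X_def start_def by (cases q) (auto simp: awalk_simps)
  have Nil_X: "[] \<in> X" using b(2) by (auto simp: X_def awalk_simps)
  have start_eq: "start q = v" if "awalk v q b" for v q
    using that by (cases q) (auto simp: start_def awalk_simps)
  \<comment> \<open>A repeated source would put a cycle inside \<open>q\<close>; by
    \<open>only_cycle\<close> it passes through \<open>b\<close>, which \<open>q\<close> meets only
    at its end.\<close>
  have dist: "distinct (map (tail G) q)" if q: "q \<in> X" for q
  proof (rule ccontr)
    assume "\<not> distinct (map (tail G) q)"
    then obtain c where c: "cycle c" "set c \<subseteq> set q" using exists_cycle_in_awalk[OF walk[OF q]] by blast
    then obtain e where "e \<in> set c" unfolding cycle_def by (meson list.set_sel(1))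
    then have "b \<in> tail G ` set c"
      using only_cycle[OF c(1), of "tail G e"] awalk_tail_leads_to[OF walk[OF q], of e] c(2) by blast
    then show False using q c(2) unfolding X_def by blast
  qed
  \<comment> \<open>All ways of closing up at \<open>b\<close> represent the same cycle
    \<open>u\<close>, so they are rotations of each other with the same first source, hence equal by
    \<open>rotate_id\<close>. This is injectivity of \<open>glue\<close> over the empty
    path.\<close>
  have closing: "u = Cycle (range (\<lambda>n. rotate n (e # q)))"
    if e: "e \<in> arcs G" "tail G e = b" and q: "q \<in> X" "head G e = start q" for e q
  proof -
    have "awalk b (e # q) b" using walk[OF q(1)] e q(2) by (auto simp: awalk_Cons_iff)
    moreover have "distinct (map (tail G) (e # q))" using dist[OF q(1)] q(1) e(2) by (auto simp: X_def)
    ultimately have "cycle (e # q)" unfolding cycle_iff_distinct_tails by blast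
    then show ?thesis using only_cycle[of "e # q" b] leads_to_refl[OF b(2)] e(2) by auto
  qed
  have rotate_id: "p = p'"
    if pp: "p' \<in> range (\<lambda>n. rotate n p)" "distinct (map (tail G) p)" "p \<noteq> []" "p' \<noteq> []"
      "tail G (hd p) = tail G (hd p')" for p p' :: "'b list"
  proof -
    obtain n where n: "p' = rotate n p" using pp(1) by blast
    have "tail G (p ! (n mod length p)) = tail G (p ! 0)"
      using pp(5) unfolding n hd_rotate_conv_nth[OF pp(3)] hd_conv_nth[OF pp(3)] by simp
    then have "map (tail G) p ! (n mod length p) = map (tail G) p ! 0" using pp(3) by simp
    then have "n mod length p = 0"
      using nth_eq_iff_index_eq[OF pp(2), of "n mod length p" 0] pp(3) by simp
    then show ?thesis using n by simp
  qed
  have "branching_system G X start glue"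
  proof
    \<comment> \<open>Arrows of paths in \<open>X\<close> start at predecessors of \<open>u\<close>,
      so row-finiteness leaves finitely many; distinct sources bound the lengths.\<close>
    let ?E = "\<Union>v\<in>predecessors G u. out_arcs G v"
    have "finite ?E" using fin rf by (auto simp: row_finite_def predecessors_def)
    moreover have "set q \<subseteq> ?E \<and> length q \<le> card ?E" if q: "q \<in> X" for q
    proof
      show sub: "set q \<subseteq> ?E"
      proof
        fix e assume e: "e \<in> set q"
        then have "e \<in> arcs G" using walk[OF q] by (auto simp: awalk_def)
        moreover have "leads_to G (tail G e) b" using awalk_tail_leads_to[OF walk[OF q] e] .
        ultimately show "e \<in> ?E" using b(1) by (auto simp: predecessors_def)
      qed
      have "distinct q" using dist[OF q] by (simp add: distinct_map)
      then show "length q \<le> card ?E"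
        using card_mono[OF \<open>finite ?E\<close> sub] by (simp add: distinct_card)
    qed
    ultimately show "finite X"
      using finite_subset[of X "{q. set q \<subseteq> ?E \<and> length q \<le> card ?E}"]
        finite_lists_length_le[of ?E "card ?E"] by blast
    show "X \<noteq> {}" using Nil_X by blast
    show "start p \<in> verts G" if "p \<in> X" for p using walk[OF that] by (simp add: awalk_def)
    show "glue e q \<in> X" if "e \<in> arcs G" "q \<in> X" "head G e = start q" for e q
    proof -
      have "awalk (tail G e) (e # q) b" using walk[OF that(2)] that by (simp add: awalk_Cons_iff)
      then show ?thesis using that(2) Nil_X unfolding glue_def by (auto simp: X_def)
    qed
    show "start (glue e q) = tail G e" for e q by (simp add: start_def glue_def)
    show "e = e' \<and> q = q'"
      if eq: "e \<in> arcs G" "q \<in> X" "head G e = start q" "e' \<in> arcs G" "q' \<in> X" "head G e' = start q'"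
        "glue e q = glue e' q'" for e q e' q'
    proof (cases "tail G e = b")
      case True
      then have "tail G e' = b" using eq(7) by (simp add: glue_def split: if_splits)
      have "range (\<lambda>n. rotate n (e # q)) = range (\<lambda>n. rotate n (e' # q'))"
        using closing[OF eq(1) True eq(2,3)] closing[OF eq(4) \<open>tail G e' = b\<close> eq(5,6)] by simp
      moreover have "e' # q' \<in> range (\<lambda>n. rotate n (e' # q'))"
        by (rule range_eqI[of _ _ 0]) simp
      ultimately have "e' # q' \<in> range (\<lambda>n. rotate n (e # q))" by simp
      moreover have "distinct (map (tail G) (e # q))" using dist[OF eq(2)] eq(2) True by (auto simp: X_def)
      ultimately have "e # q = e' # q'" using True \<open>tail G e' = b\<close> by (intro rotate_id) auto
      then show ?thesis by simp
    next
      case False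
      then show ?thesis using eq(7) by (simp add: glue_def split: if_splits)
    qed
    show "\<exists>e\<in>arcs G. \<exists>q\<in>X. head G e = start q \<and> glue e q = p"
      if p: "p \<in> X" "out_arcs G (start p) \<noteq> {}" for p
    proof (cases p)
      case (Cons e q)
      then have "awalk (head G e) q b" "e \<in> arcs G" using walk[OF p(1)] by (auto simp: awalk_Cons_iff)
      moreover have "tail G e \<noteq> b" "q \<in> X" using p(1) Cons calculation by (auto simp: X_def)
      ultimately show ?thesis using start_eq[of "head G e" q] Cons by (auto simp: glue_def)
    next
      \<comment> \<open>If \<open>b\<close> is not a sink, \<open>u\<close> is a cycle; gluing its
        arrow at \<open>b\<close> to the rest of it produces the empty path.\<close>
      case Nil
      then have "out_arcs G b \<noteq> {}" using p(2) by (simp add: start_def)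
      then have "\<exists>c. cycle c \<and> b \<in> tail G ` set c"
        using u b(1) by (cases u) fastforce+
      then obtain c where c: "cycle c" "b \<in> tail G ` set c" by blast
      then obtain e q n where "tail G e = b" "awalk (head G e) q b" "b \<notin> tail G ` set q" "set (e # q) = set c"
        using cycle_from by metis
      moreover from this have "e \<in> arcs G" "q \<in> X" using cycle_arcs[OF c(1)] by (auto simp: X_def)
      ultimately show ?thesis using start_eq[of "head G e" q] Nil
        by (intro bexI[of _ e] bexI[of _ q]) (auto simp: glue_def)
    qed
  qed
  then interpret B: branching_system G X start glue .
  obtain f :: "'b list \<Rightarrow> nat" where "inj_on f X"
    using finite_imp_inj_to_nat_seg[OF B.finite_X] by blast
  then show ?thesis using B.transfer_inj by blast
qed

section \<open>The module of a branching system\<close>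

locale leavitt_branching = leavitt F G + branching_system G X start glue
  for F :: "('k, 'r) ring_scheme" and G :: "('v, 'e) pre_digraph"
    and X :: "'x set" and start :: "'x \<Rightarrow> 'v" and glue :: "'e \<Rightarrow> 'x \<Rightarrow> 'x"
begin

abbreviation M where "M \<equiv> func_space X"

text \<open>Vectors are coordinate functions, so the operators are pullbacks. On basis vectors, the
  ghost of \<open>e\<close> sends \<open>q\<close> to \<open>glue e q\<close> if \<open>q\<close>
  starts at \<open>head G e\<close>, the arrow \<open>e\<close> sends \<open>glue e q\<close> back
  to \<open>q\<close>, and all other basis vectors go to zero. \<open>THE\<close> selects the unique
  preimage under gluing.\<close>

fun gen_op :: "('v, 'e) generator \<Rightarrow> ('x \<Rightarrow> 'k) \<Rightarrow> 'x \<Rightarrow> 'k" where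
  "gen_op (Vertex v) m = (\<lambda>i\<in>X. if start i = v then m i else \<zero>\<^bsub>F\<^esub>)"
| "gen_op (Arrow e) m = (\<lambda>i\<in>X. if start i = head G e then m (glue e i) else \<zero>\<^bsub>F\<^esub>)"
| "gen_op (Ghost e) m = (\<lambda>i\<in>X. if \<exists>q\<in>X. start q = head G e \<and> glue e q = i
      then m (THE q. q \<in> X \<and> start q = head G e \<and> glue e q = i) else \<zero>\<^bsub>F\<^esub>)"

lemma the_glue:
  assumes "e \<in> arcs G" "q \<in> X" "start q = head G e"
  shows "(THE q'. q' \<in> X \<and> start q' = head G e \<and> glue e q' = glue e q) = q"
proof (rule the_equality)
  fix q' assume "q' \<in> X \<and> start q' = head G e \<and> glue e q' = glue e q"
  then show "q' = q" using glue_inj[of e q' e q] assms by presburger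
qed (simp add: assms)

lemma gen_op_ghost_glue:
  "\<lbrakk>e \<in> arcs G; q \<in> X; start q = head G e\<rbrakk> \<Longrightarrow> gen_op (Ghost e) m (glue e q) = m q"
  using glue_closed[of e q] the_glue[of e q] by auto

text \<open>Splits by whether \<open>i\<close> arises by gluing \<open>e\<close>, which spares later
  proofs the reasoning about \<open>THE\<close>.\<close>

lemma gen_op_ghost_cases:
  assumes "e \<in> arcs G" "i \<in> X"
  obtains q where "q \<in> X" "start q = head G e" "i = glue e q" "start i = tail G e"
      "\<And>m. gen_op (Ghost e) m i = m q"
  | "\<And>q. q \<in> X \<Longrightarrow> start q = head G e \<Longrightarrow> glue e q \<noteq> i" "\<And>m. gen_op (Ghost e) m i = \<zero>\<^bsub>F\<^esub>"
proof (cases "\<exists>q\<in>X. start q = head G e \<and> glue e q = i")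
  case True
  then show ?thesis using that(1) gen_op_ghost_glue[OF assms(1)] start_glue[OF assms(1)] by metis
next
  case False
  then have "gen_op (Ghost e) m i = \<zero>\<^bsub>F\<^esub>" for m
    using assms(2) by (simp only: gen_op.simps restrict_apply' if_False)
  then show ?thesis using that(2) False by blast
qed

lemma M_carrier: "m \<in> carrier M \<longleftrightarrow> m \<in> X \<rightarrow>\<^sub>E carrier F"
  by (simp add: func_space_def)

lemma M_eqI: "m \<in> carrier M \<Longrightarrow> m' \<in> carrier M \<Longrightarrow> (\<And>i. i \<in> X \<Longrightarrow> m i = m' i) \<Longrightarrow> m = m'"
  by (auto simp: M_carrier intro: PiE_ext)

lemma M_add: "i \<in> X \<Longrightarrow> (m \<oplus>\<^bsub>M\<^esub> m') i = m i \<oplus>\<^bsub>F\<^esub> m' i"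
  and M_smult: "i \<in> X \<Longrightarrow> (c \<odot>\<^bsub>M\<^esub> m) i = c \<otimes>\<^bsub>F\<^esub> m i"
  and M_zero: "i \<in> X \<Longrightarrow> \<zero>\<^bsub>M\<^esub> i = \<zero>\<^bsub>F\<^esub>"
  by (simp_all add: func_space_def)

sublocale VM: vectorspace F M
  by (rule func_space_vectorspace)

lemma gen_op_closed:
  assumes g: "g \<in> generators G" and m: "m \<in> carrier M"
  shows "gen_op g m \<in> carrier M"
proof (cases g)
  case (Ghost e)
  then have e: "e \<in> arcs G" using g by (auto simp: generators_def)
  have "gen_op g m i \<in> carrier F" if "i \<in> X" for i
    unfolding Ghost
    by (rule gen_op_ghost_cases[OF e that]) (use m in \<open>auto simp only: M_carrier PiE_mem zero_closed\<close>)
  then show ?thesis unfolding M_carrier Ghost by (intro PiE_I) auto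
qed (use assms glue_closed in
    \<open>auto simp: M_carrier generators_def intro!: PiE_mem[of m X "\<lambda>_. carrier F"]\<close>)

sublocale O: operator_family F M "generators G" gen_op
proof (unfold_locales, rule gen_op_closed, assumption+)
  fix g m m' assume g: "g \<in> generators G" and m: "m \<in> carrier M" "m' \<in> carrier M"
  show "gen_op g (m \<oplus>\<^bsub>M\<^esub> m') = gen_op g m \<oplus>\<^bsub>M\<^esub> gen_op g m'"
  proof (rule M_eqI)
    fix i assume i: "i \<in> X"
    show "gen_op g (m \<oplus>\<^bsub>M\<^esub> m') i = (gen_op g m \<oplus>\<^bsub>M\<^esub> gen_op g m') i"
    proof (cases g)
      case (Ghost e)
      then have e: "e \<in> arcs G" using g by (auto simp: generators_def)
      show ?thesis
        unfolding Ghost by (rule gen_op_ghost_cases[OF e i]) (use i in \<open>simp_all add: M_add del: gen_op.simps\<close>)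
    qed (use i g glue_closed in \<open>auto simp: M_add generators_def\<close>)
  qed (use g m gen_op_closed in auto)
next
  fix g c m assume g: "g \<in> generators G" and m: "c \<in> carrier F" "m \<in> carrier M"
  show "gen_op g (c \<odot>\<^bsub>M\<^esub> m) = c \<odot>\<^bsub>M\<^esub> gen_op g m"
  proof (rule M_eqI)
    fix i assume i: "i \<in> X"
    show "gen_op g (c \<odot>\<^bsub>M\<^esub> m) i = (c \<odot>\<^bsub>M\<^esub> gen_op g m) i"
    proof (cases g)
      case (Ghost e)
      then have e: "e \<in> arcs G" using g by (auto simp: generators_def)
      show ?thesis
        unfolding Ghost by (rule gen_op_ghost_cases[OF e i]) (use i m in \<open>simp_all add: M_smult del: gen_op.simps\<close>)
    qed (use i g m glue_closed in \<open>auto simp: M_smult generators_def\<close>)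
  qed (use g m gen_op_closed in auto)
qed

lemma free_act_rel:
  assumes rel: "leavitt_rel F G x y" and m: "m \<in> carrier M"
  shows "O.free_act m x = O.free_act m y"
proof (rule M_eqI)
  show "O.free_act m x \<in> carrier M" "O.free_act m y \<in> carrier M"
    using leavitt_rel_closed[OF rel] m by auto
  fix i assume i: "i \<in> X"
  note mono = O.free_act_monomial
  from rel show "O.free_act m x i = O.free_act m y i"
  proof cases
    case (V v w)
    then show ?thesis using i m by (auto simp: mono O.free_act_zero M_zero)
  next
    case (E_arrow_source e)
    then show ?thesis using i m start_glue[of e i] glue_closed[of e i] wellformed by (auto simp: mono)
  next
    case (E_arrow_target e)
    then show ?thesis using i m wellformed by (auto simp: mono)
  next
    case (E_ghost_source e)
    have "gen_op (Ghost e) (gen_op (Vertex (head G e)) m) i = gen_op (Ghost e) m i"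
      by (rule gen_op_ghost_cases[OF E_ghost_source(3) i]) (simp_all del: gen_op.simps(3))
    then show ?thesis using E_ghost_source m wellformed by (simp add: mono del: gen_op.simps)
  next
    case (E_ghost_target e)
    have "gen_op (Vertex (tail G e)) (gen_op (Ghost e) m) i = gen_op (Ghost e) m i"
      by (rule gen_op_ghost_cases[OF E_ghost_target(3) i]) (use i in \<open>simp_all del: gen_op.simps(3)\<close>)
    then show ?thesis using E_ghost_target m wellformed by (simp add: mono del: gen_op.simps)
  next
    case (CK1 e f)
    have "gen_op (Arrow f) (gen_op (Ghost e) m) i
        = (if e = f \<and> start i = head G e then m i else \<zero>\<^bsub>F\<^esub>)"
    proof (cases "start i = head G f")
      case True
      have "gen_op (Ghost e) m (glue f i) = (if e = f then m i else \<zero>\<^bsub>F\<^esub>)"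
      proof (cases "e = f")
        case eq: True
        then show ?thesis using gen_op_ghost_glue[OF CK1(3) i] True by simp
      next
        case False
        then have "\<not> (\<exists>q\<in>X. start q = head G e \<and> glue e q = glue f i)"
          using glue_inj[OF CK1(3) _ _ CK1(4) i] True by metis
        then show ?thesis
          using False glue_closed[OF CK1(4) i True[symmetric]]
          by (simp only: gen_op.simps restrict_apply' if_False)
      qed
      then show ?thesis using True i by (auto simp del: gen_op.simps(3))
    qed (use i in auto)
    then show ?thesis using CK1 m i wellformed
      by (auto simp: mono O.free_act_zero M_zero simp del: gen_op.simps(2,3))
  next
    case (CK2 v)
    have closed: "(\<lambda>e. monomial F [Arrow e, Ghost e]) \<in> out_arcs G v \<rightarrow> carrier FA"
      by (auto intro!: monomial_closed)
    have terms: "(\<lambda>e. O.free_act m (monomial F [Arrow e, Ghost e])) \<in> out_arcs G v \<rightarrow> carrier M"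
      using m by (auto intro!: O.free_act_closed monomial_closed)
    \<comment> \<open>The arrow \<open>e\<close> followed by its ghost projects onto the basis
      vectors obtained by gluing \<open>e\<close>. (CK2) holds since, over a non-sink
      \<open>v\<close>, these index sets partition the indices starting at \<open>v\<close>.\<close>
    have term_eq: "O.free_act m (monomial F [Arrow e, Ghost e]) i
        = (if \<exists>q\<in>X. start q = head G e \<and> glue e q = i then m i else \<zero>\<^bsub>F\<^esub>)"
      if "e \<in> out_arcs G v" for e
    proof -
      have e: "e \<in> arcs G" using that by simp
      have "gen_op (Ghost e) (gen_op (Arrow e) m) i
          = (if \<exists>q\<in>X. start q = head G e \<and> glue e q = i then m i else \<zero>\<^bsub>F\<^esub>)"
        by (rule gen_op_ghost_cases[OF e i]) (auto simp del: gen_op.simps(3))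
      then show ?thesis using e m by (simp add: mono del: gen_op.simps)
    qed
    have mi: "m i \<in> carrier F" using m i by (auto simp: M_carrier)
    have "O.free_act m y i = (\<Oplus>\<^bsub>F\<^esub>e\<in>out_arcs G v. O.free_act m (monomial F [Arrow e, Ghost e]) i)"
      unfolding CK2(2) O.free_act_finsum[OF m closed] by (rule func_space_finsum[OF terms i])
    also have "\<dots> = (if start i = v then m i else \<zero>\<^bsub>F\<^esub>)"
    proof (cases "start i = v")
      case True
      \<comment> \<open>\<open>glue_surj\<close> supplies an arrow and \<open>glue_inj\<close> makes
        it the only one, so exactly one summand survives.\<close>
      then obtain e0 q where e0: "e0 \<in> arcs G" "q \<in> X" "head G e0 = start q" "glue e0 q = i"
        using glue_surj[OF i] CK2(4) by blast
      then have "e0 \<in> out_arcs G v" using start_glue True by auto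
      have "(\<Oplus>\<^bsub>F\<^esub>e\<in>out_arcs G v. O.free_act m (monomial F [Arrow e, Ghost e]) i)
          = (\<Oplus>\<^bsub>F\<^esub>e\<in>out_arcs G v. if e0 = e then m i else \<zero>\<^bsub>F\<^esub>)"
      proof (rule add.finprod_cong')
        fix e assume e: "e \<in> out_arcs G v"
        have "(\<exists>q\<in>X. start q = head G e \<and> glue e q = i) \<longleftrightarrow> e0 = e"
          using e e0 glue_inj[of e0 q e] by (metis in_out_arcs_conv)
        then show "O.free_act m (monomial F [Arrow e, Ghost e]) i = (if e0 = e then m i else \<zero>\<^bsub>F\<^esub>)"
          by (simp add: term_eq[OF e])
      qed (use mi in auto)
      also have "\<dots> = m i"
        using \<open>e0 \<in> out_arcs G v\<close> finite_out_arcs mi by (intro add.finprod_singleton) auto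
      finally show ?thesis using True by simp
    next
      case False
      have "(\<Oplus>\<^bsub>F\<^esub>e\<in>out_arcs G v. O.free_act m (monomial F [Arrow e, Ghost e]) i) = \<zero>\<^bsub>F\<^esub>"
      proof (rule add.finprod_one_eqI)
        fix e assume e: "e \<in> out_arcs G v"
        then have "\<not> (\<exists>q\<in>X. start q = head G e \<and> glue e q = i)"
          using start_glue False by (metis in_out_arcs_conv)
        then show "O.free_act m (monomial F [Arrow e, Ghost e]) i = \<zero>\<^bsub>F\<^esub>"
          by (simp only: term_eq[OF e] if_False)
      qed
      then show ?thesis using False by simp
    qed
    finally show ?thesis using CK2 m i by (simp add: mono)
  qed
qed

lemma free_act_ideal:
  assumes f: "f \<in> ideal_generated F FA rels" and m: "m \<in> carrier M"
  shows "O.free_act m f = \<zero>\<^bsub>M\<^esub>"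
proof -
  let ?J = "{f \<in> carrier FA. \<forall>m\<in>carrier M. O.free_act m f = \<zero>\<^bsub>M\<^esub>}"
  have "rels \<subseteq> ?J"
  proof
    fix z assume "z \<in> rels"
    then obtain x y where z: "z = x \<ominus>\<^bsub>FA\<^esub> y" and rel: "leavitt_rel F G x y" by blast
    have xy: "x \<in> carrier FA" "y \<in> carrier FA" using leavitt_rel_closed[OF rel] by auto
    have "O.free_act m z = \<zero>\<^bsub>M\<^esub>" if m: "m \<in> carrier M" for m
    proof -
      \<comment> \<open>Adding \<open>y\<close> back gives \<open>x\<close>, which acts like
        \<open>y\<close>; cancelling avoids computing the action of a negative.\<close>
      have "O.free_act m (z \<oplus>\<^bsub>FA\<^esub> y) = O.free_act m y"
        using free_act_rel[OF rel m] xy by (simp add: z a_minus_def FA.M.a_assoc FA.M.l_neg)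
      then have "O.free_act m z \<oplus>\<^bsub>M\<^esub> O.free_act m y = O.free_act m y"
        using xy m by (simp add: O.free_act_add_right z)
      then show ?thesis using xy m by (simp add: z)
    qed
    then show "z \<in> ?J" using xy z by auto
  qed
  then have "ideal_generated F FA rels \<subseteq> ?J"
    by (rule ideal_generated_least[OF O.free_act_annihilator_ideal])
  then show ?thesis using f m by blast
qed

text \<open>The choice of a representative is harmless because the ideal of relations annihilates
  the module; \<open>act_cls\<close> says so.\<close>

definition act where "act m Y = O.free_act m (SOME f. f \<in> Y)"

lemma act_cls [simp]:
  assumes f: "f \<in> carrier FA" and m: "m \<in> carrier M"
  shows "act m (L.cls f) = O.free_act m f"
proof -
  have "(SOME g. g \<in> L.cls f) \<in> L.cls f"
    using L.I.a_rcos_self[OF f] by (auto simp: some_in_eq)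
  then obtain i where i: "i \<in> ideal_generated F FA rels" "(SOME g. g \<in> L.cls f) = i \<oplus>\<^bsub>FA\<^esub> f"
    using L.in_cls_iff by blast
  then show ?thesis
    using f m free_act_ideal[OF i(1) m] L.I.a_Hcarr[OF i(1)] by (simp add: act_def O.free_act_add_right)
qed

lemma act_linear_combination:
  assumes m: "m \<in> carrier M" and S: "S \<subseteq> verts G"
  shows "act m (\<Oplus>\<^bsub>L.Q\<^esub>v\<in>S. word [Vertex v]) = (\<Oplus>\<^bsub>M\<^esub>v\<in>S. gen_op (Vertex v) m)"
proof -
  have closed: "(\<lambda>v. monomial F [Vertex v]) \<in> S \<rightarrow> carrier FA"
    using S by (auto intro!: monomial_closed)
  have "(\<Oplus>\<^bsub>L.Q\<^esub>v\<in>S. word [Vertex v]) = L.cls (\<Oplus>\<^bsub>FA\<^esub>v\<in>S. monomial F [Vertex v])"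
    by (rule additive_finsum[OF FA.M.abelian_group_axioms L.quotient_abelian_group _ _ closed, symmetric])
      (simp_all add: L.quotient_add)
  then have "act m (\<Oplus>\<^bsub>L.Q\<^esub>v\<in>S. word [Vertex v]) = (\<Oplus>\<^bsub>M\<^esub>v\<in>S. O.free_act m (monomial F [Vertex v]))"
    using closed m by (simp add: O.free_act_finsum)
  also have "\<dots> = (\<Oplus>\<^bsub>M\<^esub>v\<in>S. gen_op (Vertex v) m)"
    using S m by (intro VM.M.add.finprod_cong')
      (auto simp: O.free_act_monomial subset_iff intro!: gen_op_closed simp del: gen_op.simps)
  finally show ?thesis .
qed

lemma unital_right_module: "unital_right_module F (leavitt_path_algebra F G) M act"
  unfolding leavitt_path_algebra_eq
proof (intro unital_right_module.intro func_space_vectorspace unital_right_module_axioms.intro)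
  fix m assume m: "m \<in> carrier M"
  \<comment> \<open>Each index is fixed by exactly one of the finitely many starting vertices, so
    their sum acts as the identity, and the single term \<open>act m ?e\<close> witnesses
    unitality.\<close>
  let ?e = "\<Oplus>\<^bsub>L.Q\<^esub>v\<in>start ` X. word [Vertex v]"
  have S: "start ` X \<subseteq> verts G" using start_in_verts by blast
  have e: "?e \<in> carrier L.Q" using S by (intro LA.M.finsum_closed) (auto simp: word_closed)
  have terms: "(\<lambda>v. gen_op (Vertex v) m) \<in> start ` X \<rightarrow> carrier M"
    using S m gen_op_closed by (auto simp del: gen_op.simps)
  have "act m ?e = m"
    unfolding act_linear_combination[OF m S]
  proof (rule M_eqI)
    fix i assume i: "i \<in> X"
    have mi: "m i \<in> carrier F" using m i by (auto simp: M_carrier)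
    have "(\<Oplus>\<^bsub>M\<^esub>v\<in>start ` X. gen_op (Vertex v) m) i = (\<Oplus>\<^bsub>F\<^esub>v\<in>start ` X. gen_op (Vertex v) m i)"
      by (rule func_space_finsum[OF terms i])
    also have "\<dots> = (\<Oplus>\<^bsub>F\<^esub>v\<in>start ` X. if start i = v then m i else \<zero>\<^bsub>F\<^esub>)"
      using i by simp
    also have "\<dots> = m i"
      using i finite_X mi by (intro add.finprod_singleton) auto
    finally show "(\<Oplus>\<^bsub>M\<^esub>v\<in>start ` X. gen_op (Vertex v) m) i = m i" .
  qed (use m terms in \<open>auto intro!: VM.M.finsum_closed simp del: gen_op.simps\<close>)
  then show "\<exists>(n::nat) m' a. (\<forall>i<n. m' i \<in> carrier M \<and> a i \<in> carrier L.Q) \<and>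
      m = (\<Oplus>\<^bsub>M\<^esub>i\<in>{..<n}. act (m' i) (a i))"
    using m e by (intro exI[of _ "1::nat"] exI[of _ "\<lambda>_. m"] exI[of _ "\<lambda>_. ?e"])
      (simp add: lessThan_Suc)
qed (auto elim!: L.quotient_cases simp: L.quotient_add L.quotient_mult L.quotient_smult
      O.free_act_add_left O.free_act_add_right O.free_act_smult_left O.free_act_smult_right O.free_act_mult)

lemma nonzero_finite_dimensional_M: "nonzero_finite_dimensional F M"
proof -
  obtain i where i: "i \<in> X" using nonempty_X by blast
  have "unit_fun X i i \<noteq> \<zero>\<^bsub>M\<^esub> i" using i by (simp add: M_zero unit_fun_def)
  then have "carrier M \<noteq> {\<zero>\<^bsub>M\<^esub>}" using unit_fun_closed[of X i] by fastforce
  then show ?thesis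
    unfolding nonzero_finite_dimensional_def
    using func_space_vectorspace func_space_fin_dim[OF finite_X] by blast
qed

end

section \<open>Local units, and quotients as modules\<close>

context leavitt
begin

lemma exists_local_unit:
  assumes "a \<in> carrier L.Q"
  shows "\<exists>e\<in>carrier L.Q. a \<otimes>\<^bsub>L.Q\<^esub> e = a"
proof -
  define e where "e S = (\<Oplus>\<^bsub>L.Q\<^esub>v\<in>S. word [Vertex v])" for S
  have e_closed: "e S \<in> carrier L.Q" if "S \<subseteq> verts G" for S
    unfolding e_def using that by (intro LA.M.finsum_closed) (auto simp: word_closed)
  \<comment> \<open>Quantifying over all larger finite vertex sets makes the property pass to sums:
    the union of two such sets serves both summands.\<close>
  define U where "U S a \<longleftrightarrow> finite S \<and> S \<subseteq> verts G \<and>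
      (\<forall>S'. finite S' \<and> S \<subseteq> S' \<and> S' \<subseteq> verts G \<longrightarrow> a \<otimes>\<^bsub>L.Q\<^esub> e S' = a)" for S a
  have "\<exists>S. U S a"
    using assms
  proof (induct a rule: L_induct)
    case zero
    then show ?case using e_closed by (intro exI[of _ "{}"]) (simp add: U_def L_zero_mult)
  next
    case (add a b)
    from add(3) obtain S where S: "U S a" by (rule exE)
    from add(4) obtain T where T: "U T b" by (rule exE)
    have "U (S \<union> T) (a \<oplus>\<^bsub>L.Q\<^esub> b)"
      using S T add(1,2) e_closed by (simp add: U_def LA.mult_l_distr)
    then show ?case by (rule exI)
  next
    case (smult c a)
    from smult(3) obtain S where S: "U S a" by (rule exE)
    have "U S (c \<odot>\<^bsub>L.Q\<^esub> a)"
      using S smult(1,2) e_closed by (simp add: U_def LA.mult_smult_left)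
    then show ?case by (rule exI)
  next
    case (word w)
    then obtain v where v: "v \<in> verts G" "word w \<otimes>\<^bsub>L.Q\<^esub> word [Vertex v] = word w"
      by (rule word_target)
    have w: "word w \<in> carrier L.Q" by (rule word_closed[OF word])
    have "word w \<otimes>\<^bsub>L.Q\<^esub> e S' = word w" if S': "finite S'" "{v} \<subseteq> S'" "S' \<subseteq> verts G" for S'
    proof -
      have "word [Vertex v] \<otimes>\<^bsub>L.Q\<^esub> e S' = (\<Oplus>\<^bsub>L.Q\<^esub>v'\<in>S'. word [Vertex v] \<otimes>\<^bsub>L.Q\<^esub> word [Vertex v'])"
        unfolding e_def
        by (rule additive_finsum[OF L.quotient_abelian_group L.quotient_abelian_group])
          (use v S' in \<open>auto simp: LA.mult_r_distr word_closed\<close>)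
      also have "\<dots> = (\<Oplus>\<^bsub>L.Q\<^esub>v'\<in>S'. if v = v' then word [Vertex v] else \<zero>\<^bsub>L.Q\<^esub>)"
        using v S' by (intro LA.M.add.finprod_cong') (auto simp: word_mult word_vertex_vertex word_closed)
      also have "\<dots> = word [Vertex v]"
        using v S' by (intro LA.M.add.finprod_singleton) (auto simp: word_closed)
      finally have "word w \<otimes>\<^bsub>L.Q\<^esub> word [Vertex v] \<otimes>\<^bsub>L.Q\<^esub> e S' = word w \<otimes>\<^bsub>L.Q\<^esub> word [Vertex v]"
        using LA.mult_assoc[OF w word_closed e_closed[OF S'(3)], of "[Vertex v]"] v(1) by simp
      then show ?thesis unfolding v(2) .
    qed
    then show ?case using v(1) by (intro exI[of _ "{v}"]) (simp add: U_def)
  qed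
  then obtain S where "U S a" by (rule exE)
  then show ?thesis using e_closed[of S] unfolding U_def by (intro bexI[of _ "e S"]) simp_all
qed

text \<open>Unitality comes from local units: the coset of \<open>a\<close> equals itself times the
  coset of a local unit of \<open>a\<close>. Quotients are thereby reduced to modules.\<close>

lemma quotient_unital_right_module:
  assumes "algebra_ideal F L.Q I"
  shows "unital_right_module F L.Q (quotient_algebra L.Q I)
    (\<lambda>Y a. Y \<otimes>\<^bsub>quotient_algebra L.Q I\<^esub> (I +>\<^bsub>L.Q\<^esub> a))"
proof -
  interpret QI: algebra_with_ideal F L.Q I by unfold_locales (rule assms)
  interpret QA: nonunital_algebra F QI.Q by (rule QI.quotient_nonunital_algebra)
  show ?thesis
  proof (intro unital_right_module.intro vectorspace.intro QI.quotient_module field_axioms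
      unital_right_module_axioms.intro)
    fix Y assume Y: "Y \<in> carrier QI.Q"
    then obtain a where a: "a \<in> carrier L.Q" "Y = QI.cls a" by (rule QI.quotient_cases)
    then obtain e where e: "e \<in> carrier L.Q" "a \<otimes>\<^bsub>L.Q\<^esub> e = a" using exists_local_unit by blast
    then have "Y = Y \<otimes>\<^bsub>QI.Q\<^esub> QI.cls e" using a by (simp add: QI.quotient_mult)
    then show "\<exists>(n::nat) m a. (\<forall>i<n. m i \<in> carrier QI.Q \<and> a i \<in> carrier L.Q) \<and>
        Y = (\<Oplus>\<^bsub>QI.Q\<^esub>i\<in>{..<n}. m i \<otimes>\<^bsub>QI.Q\<^esub> QI.cls (a i))"
      using Y e by (intro exI[of _ "1::nat"] exI[of _ "\<lambda>_. Y"] exI[of _ "\<lambda>_. e"]) (simp add: lessThan_Suc)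
  qed (simp_all add: QA.mult_l_distr QA.mult_r_distr QA.mult_smult_left QA.mult_smult_right
      QA.mult_assoc flip: QI.quotient_add QI.quotient_mult QI.quotient_smult)
qed

lemma fd_module_imp_maximal:
  assumes "has_nonzero_fd_module TYPE('m) F (leavitt_path_algebra F G)"
  shows "\<exists>u. maximal_sink_or_cycle G u \<and> finite (predecessors G u)"
proof -
  obtain M :: "('k, 'm) module" and act
    where M: "unital_right_module F (leavitt_path_algebra F G) M act" "nonzero_finite_dimensional F M"
    using assms unfolding has_nonzero_fd_module_def by blast
  interpret leavitt_module F G M act
    by (intro leavitt_module.intro leavitt_axioms M(1))
  show ?thesis using graph_criterion M(2) unfolding nonzero_finite_dimensional_def by blast
qed

lemma fd_quotient_imp_maximal:
  assumes "has_nonzero_fd_quotient F (leavitt_path_algebra F G)"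
  shows "\<exists>u. maximal_sink_or_cycle G u \<and> finite (predecessors G u)"
proof -
  obtain I where I: "algebra_ideal F L.Q I" "nonzero_finite_dimensional F (quotient_algebra L.Q I)"
    using assms unfolding has_nonzero_fd_quotient_def leavitt_path_algebra_eq by blast
  \<comment> \<open>The elements of the quotient are cosets of cosets;
    \<open>fd_module_imp_maximal\<close> applies because it leaves the type of the module
    free.\<close>
  then have "has_nonzero_fd_module TYPE((('v, 'e) generator list \<Rightarrow> 'k) set set) F (leavitt_path_algebra F G)"
    unfolding has_nonzero_fd_module_def leavitt_path_algebra_eq
    using quotient_unital_right_module[OF I(1)] by blast
  then show ?thesis by (rule fd_module_imp_maximal)
qed

end

section \<open>The quotient by the annihilator\<close>

context leavitt_branching
begin

lemma has_fd_quotient: "has_nonzero_fd_quotient F (leavitt_path_algebra F G)"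
proof -
  interpret U: unital_right_module F L.Q M act
    using unital_right_module unfolding leavitt_path_algebra_eq .
  define I where "I = {a \<in> carrier L.Q. \<forall>m\<in>carrier M. act m a = \<zero>\<^bsub>M\<^esub>}"
  have act_zero_right: "act m \<zero>\<^bsub>L.Q\<^esub> = \<zero>\<^bsub>M\<^esub>" if "m \<in> carrier M" for m
    using U.act_smult_right[of "\<zero>\<^bsub>F\<^esub>" m "\<zero>\<^bsub>L.Q\<^esub>"] U.act_closed[of m "\<zero>\<^bsub>L.Q\<^esub>"] that by simp
  have act_zero_left: "act \<zero>\<^bsub>M\<^esub> a = \<zero>\<^bsub>M\<^esub>" if "a \<in> carrier L.Q" for a
    using U.act_smult_left[of "\<zero>\<^bsub>F\<^esub>" "\<zero>\<^bsub>M\<^esub>" a] U.act_closed[of "\<zero>\<^bsub>M\<^esub>" a] that by simp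
  have "algebra_ideal F L.Q I"
    unfolding algebra_ideal_def I_def
    by (auto intro!: submodule.intro LA.module_axioms U.act_closed
        simp: act_zero_right act_zero_left U.act_add_right U.act_smult_right U.act_mult)
  then interpret QI: algebra_with_ideal F L.Q I by unfold_locales
  interpret QV: vectorspace F QI.Q
    by (intro vectorspace.intro QI.quotient_module field_axioms)
  interpret W: vectorspace F "func_space (X \<times> X)" by (rule func_space_vectorspace)
  \<comment> \<open>\<open>\<Phi>\<close> takes a coset to the matrix of its action on
    \<open>M\<close>. Modulo the annihilator this is injective, so the quotient embeds into the
    \<open>X\<close> by \<open>X\<close> matrices.\<close>
  define \<Phi> where "\<Phi> Y = (\<lambda>(i, j)\<in>X \<times> X. act (unit_fun X i) (SOME a. a \<in> Y) j)" for Y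
  have act_val: "act m a j \<in> carrier F" if "m \<in> carrier M" "a \<in> carrier L.Q" "j \<in> X" for m a j
    using U.act_closed[OF that(1,2)] that(3) by (auto simp: M_carrier)
  have \<Phi>_cls: "\<Phi> (QI.cls a) = (\<lambda>(i, j)\<in>X \<times> X. act (unit_fun X i) a j)" if a: "a \<in> carrier L.Q" for a
  proof -
    have "(SOME b. b \<in> QI.cls a) \<in> QI.cls a"
      using QI.I.a_rcos_self[OF a] by (auto simp: some_in_eq)
    then obtain c where c: "c \<in> I" "(SOME b. b \<in> QI.cls a) = c \<oplus>\<^bsub>L.Q\<^esub> a"
      using QI.in_cls_iff by blast
    have "act m (c \<oplus>\<^bsub>L.Q\<^esub> a) = act m a" if m: "m \<in> carrier M" for m
    proof -
      have "c \<in> carrier L.Q" "act m c = \<zero>\<^bsub>M\<^esub>" using c(1) m unfolding I_def by blast+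
      then have "act m (c \<oplus>\<^bsub>L.Q\<^esub> a) = \<zero>\<^bsub>M\<^esub> \<oplus>\<^bsub>M\<^esub> act m a"
        using U.act_add_right[OF m _ a, of c] by (simp only:)
      then show ?thesis by (simp only: VM.M.l_zero[OF U.act_closed[OF m a]])
    qed
    then show ?thesis unfolding \<Phi>_def c(2) by (simp only: unit_fun_closed)
  qed
  have lin: "linear_map F QI.Q (func_space (X \<times> X)) \<Phi>"
  proof (intro linear_map.intro mod_hom.intro mod_hom_axioms.intro)
    show "\<Phi> \<in> module_hom F QI.Q (func_space (X \<times> X))"
      unfolding module_hom_def
    proof (intro CollectI conjI allI impI funcsetI)
      fix Y assume "Y \<in> carrier QI.Q"
      then show "\<Phi> Y \<in> carrier (func_space (X \<times> X))"
        by (elim QI.quotient_cases) (auto simp: \<Phi>_cls func_space_def act_val[OF unit_fun_closed])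
    next
      fix Y Z assume "Y \<in> carrier QI.Q \<and> Z \<in> carrier QI.Q"
      then obtain a b where ab: "a \<in> carrier L.Q" "Y = QI.cls a" "b \<in> carrier L.Q" "Z = QI.cls b"
        by (elim conjE QI.quotient_cases)
      then show "\<Phi> (Y \<oplus>\<^bsub>QI.Q\<^esub> Z) = \<Phi> Y \<oplus>\<^bsub>func_space (X \<times> X)\<^esub> \<Phi> Z"
        by (auto simp: QI.quotient_add \<Phi>_cls func_space_def U.act_add_right[OF unit_fun_closed] M_add intro!: restrict_ext)
    next
      fix c Y assume "c \<in> carrier F \<and> Y \<in> carrier QI.Q"
      then obtain a where "c \<in> carrier F" "a \<in> carrier L.Q" "Y = QI.cls a"
        by (elim conjE QI.quotient_cases)
      then show "\<Phi> (c \<odot>\<^bsub>QI.Q\<^esub> Y) = c \<odot>\<^bsub>func_space (X \<times> X)\<^esub> \<Phi> Y"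
        by (auto simp: QI.quotient_smult \<Phi>_cls func_space_def U.act_smult_right[OF _ unit_fun_closed] M_smult intro!: restrict_ext)
    qed
  qed unfold_locales
  interpret \<Phi>: linear_map F QI.Q "func_space (X \<times> X)" \<Phi> by (rule lin)
  have ker: "Y = \<zero>\<^bsub>QI.Q\<^esub>" if Y: "Y \<in> carrier QI.Q" "\<Phi> Y = \<zero>\<^bsub>func_space (X \<times> X)\<^esub>" for Y
  proof -
    obtain a where a: "a \<in> carrier L.Q" "Y = QI.cls a" using Y(1) by (rule QI.quotient_cases)
    have zero: "act (unit_fun X i) a = \<zero>\<^bsub>M\<^esub>" if i: "i \<in> X" for i
    proof (rule M_eqI)
      fix j assume j: "j \<in> X"
      have "\<Phi> Y (i, j) = \<zero>\<^bsub>F\<^esub>" using Y(2) i j by (simp add: func_space_def)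
      then show "act (unit_fun X i) a j = \<zero>\<^bsub>M\<^esub> j" using a i j by (simp add: \<Phi>_cls M_zero)
    qed (use a U.act_closed in auto)
    \<comment> \<open>An element killing the standard basis vectors kills \<open>M\<close>, so a
      zero matrix means membership in \<open>I\<close>.\<close>
    have "act m a = \<zero>\<^bsub>M\<^esub>" if m: "m \<in> carrier M" for m
    proof -
      have mi: "m i \<in> carrier F" if "i \<in> X" for i using m that by (auto simp: M_carrier)
      have "act m a = act (\<Oplus>\<^bsub>M\<^esub>i\<in>X. m i \<odot>\<^bsub>M\<^esub> unit_fun X i) a"
        using func_space_expand[OF finite_X m] by simp
      also have "\<dots> = (\<Oplus>\<^bsub>M\<^esub>i\<in>X. act (m i \<odot>\<^bsub>M\<^esub> unit_fun X i) a)"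
        by (rule additive_finsum[OF VM.M.abelian_group_axioms VM.M.abelian_group_axioms,
              where h = "\<lambda>m. act m a"])
          (use a mi in \<open>auto simp: U.act_add_left U.act_closed\<close>)
      also have "\<dots> = \<zero>\<^bsub>M\<^esub>"
        using zero a mi by (intro VM.M.add.finprod_one_eqI) (simp add: U.act_smult_left)
      finally show ?thesis .
    qed
    then have "a \<in> I" unfolding I_def using a(1) by blast
    then have "QI.cls a = I" by (rule QI.I.a_rcos_const)
    then show ?thesis unfolding a(2) quotient_algebra_def by simp
  qed
  then have "inj_on \<Phi> (carrier QI.Q)"
    by (intro \<Phi>.Ke0_imp_inj) (auto simp: \<Phi>.ker_def)
  then have fd: "QV.fin_dim"
    using \<Phi>.inj_imp_fin_dim func_space_fin_dim[of "X \<times> X"] finite_X by blast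
  have "carrier QI.Q \<noteq> {\<zero>\<^bsub>QI.Q\<^esub>}"
  proof
    \<comment> \<open>If the quotient vanished, the whole algebra would annihilate \<open>M\<close>,
      and unitality would make \<open>M\<close> zero.\<close>
    assume trivial: "carrier QI.Q = {\<zero>\<^bsub>QI.Q\<^esub>}"
    have "a \<in> I" if a: "a \<in> carrier L.Q" for a
    proof -
      have "QI.cls a = I" using QI.cls_closed[OF a] trivial by (simp add: quotient_algebra_def)
      then show ?thesis using QI.I.a_rcos_self[OF a] by simp
    qed
    then have act0: "act m a = \<zero>\<^bsub>M\<^esub>" if "m \<in> carrier M" "a \<in> carrier L.Q" for m a
      using that unfolding I_def by blast
    have "m = \<zero>\<^bsub>M\<^esub>" if "m \<in> carrier M" for m
    proof -
      obtain n m' a where "\<forall>i<n::nat. m' i \<in> carrier M \<and> a i \<in> carrier L.Q"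
          "m = (\<Oplus>\<^bsub>M\<^esub>i\<in>{..<n}. act (m' i) (a i))"
        using U.unital[OF \<open>m \<in> carrier M\<close>] by blast
      then show ?thesis using act0 by (auto intro!: VM.M.add.finprod_one_eqI)
    qed
    then show False
      using nonzero_finite_dimensional_M VM.M.zero_closed
      unfolding nonzero_finite_dimensional_def by blast
  qed
  then have "nonzero_finite_dimensional F QI.Q"
    unfolding nonzero_finite_dimensional_def using fd QV.vectorspace_axioms by blast
  then show ?thesis
    unfolding has_nonzero_fd_quotient_def leavitt_path_algebra_eq using QI.ideal by blast
qed

end

lemma (in leavitt) maximal_imp_fd:
  assumes "maximal_sink_or_cycle G u" "finite (predecessors G u)"
  shows "has_nonzero_fd_module TYPE(nat \<Rightarrow> 'k) F (leavitt_path_algebra F G)"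
    and "has_nonzero_fd_quotient F (leavitt_path_algebra F G)"
proof -
  obtain X :: "nat set" and start glue where "branching_system G X start glue"
    using exists_branching_system[OF row_finite assms] by blast
  then interpret leavitt_branching F G X start glue
    by (intro leavitt_branching.intro leavitt_axioms)
  show "has_nonzero_fd_module TYPE(nat \<Rightarrow> 'k) F (leavitt_path_algebra F G)"
    unfolding has_nonzero_fd_module_def
    using unital_right_module nonzero_finite_dimensional_M by blast
  show "has_nonzero_fd_quotient F (leavitt_path_algebra F G)" by (rule has_fd_quotient)
qed

text \<open>The free type \<open>'m\<close> lets necessity of the graph condition cover modules with
  elements of any type, beyond the one in which sufficiency constructs a module.\<close>

theorem theorem6p5:
  fixes F :: "('k, 'r) ring_scheme" and G :: "('v, 'e) pre_digraph"
  assumes "field F" and "wf_digraph G" and "row_finite G"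
  shows
    "(has_nonzero_fd_module TYPE(nat \<Rightarrow> 'k) F (leavitt_path_algebra F G) \<longleftrightarrow>
        (\<exists>u. maximal_sink_or_cycle G u \<and> finite (predecessors G u))) \<and>
     (has_nonzero_fd_module TYPE('m) F (leavitt_path_algebra F G) \<longrightarrow>
        (\<exists>u. maximal_sink_or_cycle G u \<and> finite (predecessors G u))) \<and>
     (has_nonzero_fd_quotient F (leavitt_path_algebra F G) \<longleftrightarrow>
        (\<exists>u. maximal_sink_or_cycle G u \<and> finite (predecessors G u)))"
proof -
  interpret leavitt F G
    using assms by (intro leavitt.intro leavitt_axioms.intro)
  show ?thesis
    using fd_module_imp_maximal[where 'm = "nat \<Rightarrow> 'k"] fd_module_imp_maximal[where 'm = 'm]
      fd_quotient_imp_maximal maximal_imp_fd by blast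
qed

end
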